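(* Let $n\ge 2$, let $\mathbb{D}=\{z\in\mathbb{C}:|z|<1\}$, let $\mathbb{B}^n$ be the open unit ball of $\mathbb{R}^n$, and let $f:\mathbb{D}\to\mathbb{B}^n$ be a harmonic map. If $f$ is conformal at a point $z\in\mathbb{D}$ and $\theta\in[0,\pi/2]$ denotes the angle between the vector $f(z)$ and the plane $\Lambda=df_z(\mathbb{R}^2)\subset\mathbb{R}^n$, then $$\|df_z\|=\frac{1}{\sqrt2}\,|\nabla f(z)|\ \le\ \frac{1-|f(z)|^2}{1-|z|^2}\cdot\frac{1}{\sqrt{1-|f(z)|^2\sin^2\theta}},$$ with equality in the inequality if and only if $f$ is a conformal diffeomorphism of $\mathbb{D}$ onto the affine disc $\Sigma=(f(z)+\Lambda)\cap\mathbb{B}^n$. (When $f(z)=0$ or $df_z=0$, the angle $\theta$ does not matter.)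
   Context: Write $z=x+iy$. A map $f=(f_1,\dots,f_n):\mathbb{D}\to\mathbb{R}^n$ is harmonic if every component $f_k$ is a harmonic function. $f$ is conformal at $z$ if $|f_x(z)|=|f_y(z)|$ and $f_x(z)\cdot f_y(z)=0$ (Euclidean norm and inner product); $df_z=0$ is allowed, and otherwise $\Lambda=df_z(\mathbb{R}^2)$ is a 2-plane through the origin. $\|df_z\|$ is the operator norm of the differential, and $|\nabla f(z)|^2=|f_x(z)|^2+|f_y(z)|^2$. Conformal diffeomorphisms onto $\Sigma$ may preserve or reverse orientation. *)

theory Defs
  imports "HOL-Analysis.Analysis"
begin

text \<open>Continuous differentiability of order \<open>k\<close>, intended for open sets \<open>U\<close>.\<close>

primrec Ck_on :: "nat \<Rightarrow> 'a::euclidean_space set \<Rightarrow> ('a \<Rightarrow> 'b::euclidean_space) \<Rightarrow> bool" where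
  "Ck_on 0 U f \<longleftrightarrow> continuous_on U f"
| "Ck_on (Suc k) U f \<longleftrightarrow>
     (\<forall>x\<in>U. f differentiable (at x)) \<and>
     (\<forall>v. Ck_on k U (\<lambda>x. frechet_derivative f (at x) v))"

text \<open>Smoothness on an arbitrary set: near each of its points, the map is the restriction of a
  \<open>C\<^sup>\<infinity>\<close> map defined on an open subset of the ambient space. On an open set this is ordinary
  \<open>C\<^sup>\<infinity>\<close> smoothness; on an embedded submanifold it is smoothness in the sense of manifolds.\<close>

definition smooth_map_on :: "'a::euclidean_space set \<Rightarrow> ('a \<Rightarrow> 'b::euclidean_space) \<Rightarrow> bool" where
  "smooth_map_on S f \<longleftrightarrow>
     (\<forall>x\<in>S. \<exists>U g. open U \<and> x \<in> U \<and> (\<forall>k. Ck_on k U g) \<and> (\<forall>y\<in>S \<inter> U. g y = f y))"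

definition diffeomorphism_onto ::
    "('a::euclidean_space \<Rightarrow> 'b::euclidean_space) \<Rightarrow> 'a set \<Rightarrow> 'b set \<Rightarrow> bool" where
  "diffeomorphism_onto f S T \<longleftrightarrow>
     bij_betw f S T \<and> smooth_map_on S f \<and> smooth_map_on T (inv_into S f)"

definition partial_x :: "(complex \<Rightarrow> 'b::real_normed_vector) \<Rightarrow> complex \<Rightarrow> 'b" where
  "partial_x f z = frechet_derivative f (at z) 1"

definition partial_y :: "(complex \<Rightarrow> 'b::real_normed_vector) \<Rightarrow> complex \<Rightarrow> 'b" where
  "partial_y f z = frechet_derivative f (at z) \<i>"

definition harmonic_fun_on :: "complex set \<Rightarrow> (complex \<Rightarrow> real) \<Rightarrow> bool" where
  "harmonic_fun_on U u \<longleftrightarrow>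
     Ck_on 2 U u \<and>
     (\<forall>z\<in>U. partial_x (partial_x u) z + partial_y (partial_y u) z = 0)"

definition harmonic_map_on :: "complex set \<Rightarrow> (complex \<Rightarrow> real ^ 'n) \<Rightarrow> bool" where
  "harmonic_map_on U f \<longleftrightarrow> (\<forall>k. harmonic_fun_on U (\<lambda>z. f z $ k))"

definition conformal_at :: "(complex \<Rightarrow> real ^ 'n) \<Rightarrow> complex \<Rightarrow> bool" where
  "conformal_at f z \<longleftrightarrow>
     norm (partial_x f z) = norm (partial_y f z) \<and> partial_x f z \<bullet> partial_y f z = 0"

definition grad_norm :: "(complex \<Rightarrow> real ^ 'n) \<Rightarrow> complex \<Rightarrow> real" where
  "grad_norm f z = sqrt ((norm (partial_x f z))\<^sup>2 + (norm (partial_y f z))\<^sup>2)"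

text \<open>A diffeomorphism has injective differential, so vanishing of the differential, which
  \<^const>\<open>conformal_at\<close> permits, does not occur here. Either orientation is allowed.\<close>

definition conformal_diffeomorphism_onto ::
    "(complex \<Rightarrow> real ^ 'n) \<Rightarrow> complex set \<Rightarrow> (real ^ 'n) set \<Rightarrow> bool" where
  "conformal_diffeomorphism_onto f S T \<longleftrightarrow>
     diffeomorphism_onto f S T \<and> (\<forall>w\<in>S. conformal_at f w)"

definition vec_angle :: "'a::real_inner \<Rightarrow> 'a \<Rightarrow> real" where
  "vec_angle v w = arccos (v \<bullet> w / (norm v * norm w))"

text \<open>The least angle between \<open>v\<close> and a nonzero vector of the linear subspace \<open>L\<close>; it lies in
  \<open>[0, pi/2]\<close>, because \<open>L\<close> contains \<open>-w\<close> along with \<open>w\<close>. Meaningful only for \<open>v \<noteq> 0\<close> and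
  \<open>L \<noteq> {0}\<close>.\<close>

definition angle_to_subspace :: "'a::real_inner \<Rightarrow> 'a set \<Rightarrow> real" where
  "angle_to_subspace v L = (INF w\<in>L - {0}. vec_angle v w)"

end

theory Submission
  imports Defs "HOL-Complex_Analysis.Riemann_Mapping"
begin

text \<open>
  The proof compares \<open>f\<close> with the explicit conformal parametrisation \<open>g\<close> of the affine disc
  \<open>\<Sigma>\<close>. After a conformal automorphism of the unit disc one may take \<open>z = 0\<close>. Then \<open>g\<close> is an affine
  isometric image of a Moebius transformation, \<open>g 0 = f 0\<close>, and for a suitable choice of \<open>g\<close> the
  differential of \<open>f\<close> at \<open>0\<close> is a positive multiple \<open>t\<close> of that of \<open>g\<close>, since both are conformal
  with the same image plane. The claim is that \<open>t \<le> 1\<close>, with equality only for \<open>f = g\<close>.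

  Let \<open>w \<omega> = |1 + cnj a \<omega>|\<^sup>2\<close> be the squared modulus of the denominator of the Moebius transformation.
  On the unit circle \<open>|g| = 1\<close>, so for \<open>f\<close> in the unit ball \<open>w (1 - f \<bullet> g) \<ge> 0\<close> there. Moreover \<open>w\<close> and
  \<open>w g\<close> are trigonometric polynomials of degree one, so the mean of \<open>w (1 - f \<bullet> g)\<close> over the circle
  involves only the value and the differential of \<open>f\<close> at \<open>0\<close>: it is an affine function of \<open>t\<close>,
  decreasing, and zero for \<open>t = 1\<close> because it vanishes for \<open>f = g\<close>. Hence \<open>t \<le> 1\<close>. If
  \<open>t = 1\<close> then \<open>|f - g|\<^sup>2 \<le> 2 (1 - f \<bullet> g)\<close> forces \<open>f = g\<close>.

  The argument is carried out without boundary values or integrals. The components of \<open>f\<close> are real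
  parts of holomorphic functions, and the mean over the circle of radius \<open>\<rho> < 1\<close> is replaced by the
  value at \<open>0\<close> of a holomorphic function, \<open>gap \<rho>\<close>, whose real part is
  \<open>w (\<zeta> / \<rho>) (1 - f \<zeta> \<bullet> g (\<zeta> / \<rho>))\<close> on that circle. The maximum principle then does the work of
  the integral, and \<open>\<rho>\<close> tends to \<open>1\<close>; see \<open>radius_bound\<close> and \<open>equality_imp_model\<close>.

  For the converse, a conformal harmonic diffeomorphism onto \<open>\<Sigma>\<close> is a holomorphic bijection between
  planar discs in suitable coordinates, and the Schwarz lemma for its inverse gives the opposite
  inequality; see \<open>conformal_diffeomorphism_imp_equality\<close>. The number in the statement comes from the
  radius of \<open>\<Sigma>\<close>: its centre has norm \<open>|f z| sin \<theta>\<close> by \<open>norm_sin_angle_to_plane\<close>.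
\<close>

section \<open>Harmonic functions as real parts of holomorphic functions\<close>

text \<open>The second difference of \<open>u\<close> over a parallelogram is symmetric in its two sides, so evaluating it by
the mean value theorem in either order compares the two mixed derivatives.\<close>

lemma second_difference_mean_value:
  fixes u :: "'a::euclidean_space \<Rightarrow> real"
  assumes h: "0 < h"
    and sq: "\<And>s t. s \<in> {0..h} \<Longrightarrow> t \<in> {0..h} \<Longrightarrow> z + s *\<^sub>R v + t *\<^sub>R w \<in> U"
    and d1: "\<And>x. x \<in> U \<Longrightarrow> u differentiable (at x)"
    and d2: "\<And>x. x \<in> U \<Longrightarrow> (\<lambda>y. frechet_derivative u (at y) v) differentiable (at x)"
  shows "\<exists>s\<in>{0..h}. \<exists>t\<in>{0..h}.
    u (z + h *\<^sub>R v + h *\<^sub>R w) - u (z + h *\<^sub>R v) - (u (z + h *\<^sub>R w) - u z)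
      = h * (h * frechet_derivative (\<lambda>y. frechet_derivative u (at y) v) (at (z + s *\<^sub>R v + t *\<^sub>R w)) w)"
proof -
  define D where "D = (\<lambda>y. frechet_derivative u (at y) v)"
  define D2 where "D2 = (\<lambda>y. frechet_derivative D (at y) w)"
  have line: "((\<lambda>s. g (b + s *\<^sub>R e)) has_real_derivative frechet_derivative g (at (b + s *\<^sub>R e)) e) (at s)"
    if "g differentiable (at (b + s *\<^sub>R e))" for g :: "'a \<Rightarrow> real" and b e s
  proof -
    have g: "(g has_derivative frechet_derivative g (at (b + s *\<^sub>R e))) (at (b + s *\<^sub>R e))"
      using that frechet_derivative_works by blast
    have "((\<lambda>s. g (b + s *\<^sub>R e)) has_derivative
        (\<lambda>t. frechet_derivative g (at (b + s *\<^sub>R e)) (t *\<^sub>R e))) (at s)"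
      by (rule has_derivative_compose[where g = g and f = "\<lambda>s. b + s *\<^sub>R e", OF _ g])
        (auto intro!: derivative_eq_intros)
    moreover have "(\<lambda>t. frechet_derivative g (at (b + s *\<^sub>R e)) (t *\<^sub>R e))
        = (*) (frechet_derivative g (at (b + s *\<^sub>R e)) e)"
      using linear_frechet_derivative[OF that] by (auto simp: linear_cmul fun_eq_iff)
    ultimately show ?thesis by (simp add: has_field_derivative_def)
  qed
  have "\<exists>s. 0 < s \<and> s < h \<and> (u (z + h *\<^sub>R w + h *\<^sub>R v) - u (z + h *\<^sub>R v)) -
        (u (z + h *\<^sub>R w + 0 *\<^sub>R v) - u (z + 0 *\<^sub>R v))
      = (h - 0) * (D (z + h *\<^sub>R w + s *\<^sub>R v) - D (z + s *\<^sub>R v))"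
  proof (rule MVT2[OF h])
    fix s assume s: "0 \<le> s" "s \<le> h"
    have 1: "z + h *\<^sub>R w + s *\<^sub>R v \<in> U" using sq[of s h] s h by (simp add: add_ac)
    have 2: "z + s *\<^sub>R v \<in> U" using sq[of s 0] s h by simp
    show "((\<lambda>s. u (z + h *\<^sub>R w + s *\<^sub>R v) - u (z + s *\<^sub>R v)) has_real_derivative
        D (z + h *\<^sub>R w + s *\<^sub>R v) - D (z + s *\<^sub>R v)) (at s)"
      unfolding D_def by (intro DERIV_diff line d1 1 2)
  qed
  then obtain s where s: "0 < s" "s < h" and e1: "(u (z + h *\<^sub>R w + h *\<^sub>R v) - u (z + h *\<^sub>R v)) -
        (u (z + h *\<^sub>R w) - u z) = h * (D (z + h *\<^sub>R w + s *\<^sub>R v) - D (z + s *\<^sub>R v))"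
    by auto
  have "\<exists>t. 0 < t \<and> t < h \<and> D (z + s *\<^sub>R v + h *\<^sub>R w) - D (z + s *\<^sub>R v + 0 *\<^sub>R w)
      = (h - 0) * D2 (z + s *\<^sub>R v + t *\<^sub>R w)"
  proof (rule MVT2[OF h])
    fix t assume t: "0 \<le> t" "t \<le> h"
    have "z + s *\<^sub>R v + t *\<^sub>R w \<in> U" using sq[of s t] s t by simp
    then show "((\<lambda>t. D (z + s *\<^sub>R v + t *\<^sub>R w)) has_real_derivative D2 (z + s *\<^sub>R v + t *\<^sub>R w)) (at t)"
      unfolding D2_def by (intro line) (use d2 in \<open>simp add: D_def\<close>)
  qed
  then obtain t where t: "0 < t" "t < h" and e2: "D (z + s *\<^sub>R v + h *\<^sub>R w) - D (z + s *\<^sub>R v)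
      = h * D2 (z + s *\<^sub>R v + t *\<^sub>R w)"
    by auto
  have "z + h *\<^sub>R w + s *\<^sub>R v = z + s *\<^sub>R v + h *\<^sub>R w" "z + h *\<^sub>R w + h *\<^sub>R v = z + h *\<^sub>R v + h *\<^sub>R w"
    by (simp_all add: add_ac)
  with e1 e2 have "u (z + h *\<^sub>R v + h *\<^sub>R w) - u (z + h *\<^sub>R v) - (u (z + h *\<^sub>R w) - u z)
      = h * (h * D2 (z + s *\<^sub>R v + t *\<^sub>R w))"
    by simp
  moreover have "s \<in> {0..h}" "t \<in> {0..h}" using s t by auto
  ultimately show ?thesis unfolding D2_def D_def by blast
qed

lemma mixed_derivatives_commute:
  fixes u :: "'a::euclidean_space \<Rightarrow> real"
  assumes "open U" "z \<in> U" "Ck_on 2 U u"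
  shows "frechet_derivative (\<lambda>y. frechet_derivative u (at y) v) (at z) w
       = frechet_derivative (\<lambda>y. frechet_derivative u (at y) w) (at z) v"
proof -
  define D where "D = (\<lambda>v y. frechet_derivative u (at y) v)"
  define D2 where "D2 = (\<lambda>v w y. frechet_derivative (D v) (at y) w)"
  have d1: "\<And>x. x \<in> U \<Longrightarrow> u differentiable (at x)"
    and d2: "\<And>v x. x \<in> U \<Longrightarrow> D v differentiable (at x)"
    and c2: "\<And>v w. continuous_on U (D2 v w)"
    using assms(3) by (auto simp: numeral_2_eq_2 D_def D2_def)
  have "D2 v w z = D2 w v z"
  proof (rule ccontr)
    assume "D2 v w z \<noteq> D2 w v z"
    define \<epsilon> where "\<epsilon> = \<bar>D2 v w z - D2 w v z\<bar> / 2"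
    have \<epsilon>: "\<epsilon> > 0" using \<open>D2 v w z \<noteq> D2 w v z\<close> by (simp add: \<epsilon>_def)
    have near: "\<exists>\<delta>>0. \<forall>x. dist x z < \<delta> \<longrightarrow> dist (D2 v w x) (D2 v w z) < \<epsilon>" for v w
    proof -
      have "isCont (D2 v w) z" using c2 assms continuous_on_eq_continuous_at by blast
      then show ?thesis using \<epsilon> by (auto simp: continuous_at_eps_delta)
    qed
    obtain \<delta>1 where \<delta>1: "\<delta>1 > 0" "\<And>x. dist x z < \<delta>1 \<Longrightarrow> dist (D2 v w x) (D2 v w z) < \<epsilon>"
      using near by blast
    obtain \<delta>2 where \<delta>2: "\<delta>2 > 0" "\<And>x. dist x z < \<delta>2 \<Longrightarrow> dist (D2 w v x) (D2 w v z) < \<epsilon>"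
      using near by blast
    obtain \<delta>3 where \<delta>3: "\<delta>3 > 0" "ball z \<delta>3 \<subseteq> U"
      using assms open_contains_ball by blast
    define \<delta> where "\<delta> = min \<delta>1 (min \<delta>2 \<delta>3)"
    define h where "h = \<delta> / (norm v + norm w + 1) / 2"
    have "\<delta> > 0" using \<delta>1 \<delta>2 \<delta>3 by (simp add: \<delta>_def)
    have nz: "norm v + norm w + 1 > 0" by (simp add: add_nonneg_pos)
    have h: "h > 0" using \<open>\<delta> > 0\<close> nz by (simp add: h_def)
    have hd: "h * (norm v + norm w) < \<delta>"
    proof -
      have "h * (norm v + norm w) \<le> h * (norm v + norm w + 1)" using h by simp
      also have "\<dots> = \<delta> / 2" using nz unfolding h_def by (auto simp: divide_simps)
      also have "\<dots> < \<delta>" using \<open>\<delta> > 0\<close> by simp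
      finally show ?thesis .
    qed
    have sq: "dist (z + s *\<^sub>R v + t *\<^sub>R w) z < \<delta>" if "s \<in> {0..h}" "t \<in> {0..h}" for s t
    proof -
      have "dist (z + s *\<^sub>R v + t *\<^sub>R w) z = norm (s *\<^sub>R v + t *\<^sub>R w)"
        by (simp add: dist_norm add.assoc)
      also have "\<dots> \<le> norm (s *\<^sub>R v) + norm (t *\<^sub>R w)" by (rule norm_triangle_ineq)
      also have "\<dots> \<le> h * norm v + h * norm w"
        using that by (auto intro!: add_mono mult_right_mono)
      finally show ?thesis using hd by (simp add: algebra_simps)
    qed
    have inU: "x \<in> U" if "dist x z < \<delta>" for x
      using that \<delta>3 by (auto simp: \<delta>_def dist_commute subset_iff)
    have sd: "\<exists>s\<in>{0..h}. \<exists>t\<in>{0..h}.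
        u (z + h *\<^sub>R v + h *\<^sub>R w) - u (z + h *\<^sub>R v) - (u (z + h *\<^sub>R w) - u z)
          = h * (h * D2 v w (z + s *\<^sub>R v + t *\<^sub>R w))"
      if "\<And>s t. s \<in> {0..h} \<Longrightarrow> t \<in> {0..h} \<Longrightarrow> z + s *\<^sub>R v + t *\<^sub>R w \<in> U" for v w
      unfolding D2_def D_def
      by (rule second_difference_mean_value[where U = U, OF h that d1 d2[unfolded D_def]])
    obtain s t where st: "s \<in> {0..h}" "t \<in> {0..h}"
      "u (z + h *\<^sub>R v + h *\<^sub>R w) - u (z + h *\<^sub>R v) - (u (z + h *\<^sub>R w) - u z)
        = h * (h * D2 v w (z + s *\<^sub>R v + t *\<^sub>R w))"
      using sd[OF inU[OF sq]] by meson
    have inU': "z + s *\<^sub>R w + t *\<^sub>R v \<in> U" if "s \<in> {0..h}" "t \<in> {0..h}" for s t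
      using inU[OF sq[OF that(2,1)]] by (simp add: add_ac)
    obtain s' t' where st': "s' \<in> {0..h}" "t' \<in> {0..h}"
      "u (z + h *\<^sub>R w + h *\<^sub>R v) - u (z + h *\<^sub>R w) - (u (z + h *\<^sub>R v) - u z)
        = h * (h * D2 w v (z + s' *\<^sub>R w + t' *\<^sub>R v))"
      using sd[OF inU'] by meson
    have "z + h *\<^sub>R w + h *\<^sub>R v = z + h *\<^sub>R v + h *\<^sub>R w"
      "z + s' *\<^sub>R w + t' *\<^sub>R v = z + t' *\<^sub>R v + s' *\<^sub>R w" by (simp_all add: add_ac)
    with st(3) st'(3) h have "D2 v w (z + s *\<^sub>R v + t *\<^sub>R w) = D2 w v (z + t' *\<^sub>R v + s' *\<^sub>R w)"
      by (simp add: algebra_simps)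
    moreover have "dist (D2 v w (z + s *\<^sub>R v + t *\<^sub>R w)) (D2 v w z) < \<epsilon>"
      using \<delta>1(2) sq[OF st(1,2)] by (simp add: \<delta>_def)
    moreover have "dist (D2 w v (z + t' *\<^sub>R v + s' *\<^sub>R w)) (D2 w v z) < \<epsilon>"
      using \<delta>2(2) sq[OF st'(2,1)] by (simp add: \<delta>_def)
    ultimately have "dist (D2 v w z) (D2 w v z) < \<epsilon> + \<epsilon>"
      by (metis add_strict_mono dist_commute dist_triangle order.strict_trans1)
    then show False by (simp add: dist_real_def \<epsilon>_def)
  qed
  then show ?thesis by (simp add: D2_def D_def)
qed

lemma frechet_derivative_complex_direction:
  assumes "f differentiable (at z)"
  shows "frechet_derivative f (at z) d = Re d *\<^sub>R partial_x f z + Im d *\<^sub>R partial_y f z"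
proof -
  interpret linear "frechet_derivative f (at z)"
    using linear_frechet_derivative[OF assms] .
  have "frechet_derivative f (at z) (Re d *\<^sub>R 1 + Im d *\<^sub>R \<i>)
      = Re d *\<^sub>R partial_x f z + Im d *\<^sub>R partial_y f z"
    unfolding add scale by (simp add: partial_x_def partial_y_def)
  moreover have "Re d *\<^sub>R 1 + Im d *\<^sub>R \<i> = d" by (simp add: complex_eq_iff)
  ultimately show ?thesis by simp
qed

text \<open>For harmonic \<open>u\<close>, the Cauchy-Riemann equations for \<open>u\<^sub>x - i u\<^sub>y\<close> are Laplace's equation together with
the symmetry of the mixed derivatives; on a convex set this function has a primitive, whose real part
has the same gradient as \<open>u\<close>.\<close>

lemma harmonic_imp_Re_holomorphic:
  assumes "harmonic_fun_on U u" "open U" "convex U"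
  obtains h where "h holomorphic_on U" "\<And>z. z \<in> U \<Longrightarrow> Re (h z) = u z"
proof (cases "U = {}")
  case True
  then show thesis by (intro that[of "\<lambda>z. 0"]) auto
next
  case False
  then obtain z0 where z0: "z0 \<in> U" by blast
  have C2: "Ck_on 2 U u" and lap: "\<And>z. z \<in> U \<Longrightarrow> partial_x (partial_x u) z + partial_y (partial_y u) z = 0"
    using assms(1) by (auto simp: harmonic_fun_on_def)
  have du: "\<And>z. z \<in> U \<Longrightarrow> u differentiable (at z)"
    and dx: "\<And>z. z \<in> U \<Longrightarrow> partial_x u differentiable (at z)"
    and dy: "\<And>z. z \<in> U \<Longrightarrow> partial_y u differentiable (at z)"
    using C2 by (auto simp: numeral_2_eq_2 partial_x_def[abs_def] partial_y_def[abs_def])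
  define F where "F = (\<lambda>z. complex_of_real (partial_x u z) - \<i> * complex_of_real (partial_y u z))"
  have "F holomorphic_on U"
    unfolding holomorphic_on_def
  proof
    fix z assume z: "z \<in> U"
    let ?A = "partial_x (partial_x u) z" and ?B = "partial_y (partial_x u) z"
    have B: "partial_x (partial_y u) z = ?B"
      using mixed_derivatives_commute[OF assms(2) z C2, of "\<i>" 1]
      by (simp add: partial_x_def[abs_def] partial_y_def[abs_def])
    have A: "partial_y (partial_y u) z = - ?A" using lap[OF z] by simp
    have "frechet_derivative (partial_x u) (at z) = (\<lambda>d. Re d * ?A + Im d * ?B)"
      unfolding frechet_derivative_complex_direction[OF dx[OF z]] by (simp add: fun_eq_iff)
    then have 1: "(partial_x u has_derivative (\<lambda>d. Re d * ?A + Im d * ?B)) (at z)"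
      using dx[OF z] frechet_derivative_works by metis
    have "frechet_derivative (partial_y u) (at z) = (\<lambda>d. Re d * ?B - Im d * ?A)"
      unfolding frechet_derivative_complex_direction[OF dy[OF z]] A B by (simp add: fun_eq_iff)
    then have 2: "(partial_y u has_derivative (\<lambda>d. Re d * ?B - Im d * ?A)) (at z)"
      using dy[OF z] frechet_derivative_works by metis
    have "(F has_derivative (\<lambda>d. complex_of_real (Re d * ?A + Im d * ?B)
        - \<i> * complex_of_real (Re d * ?B - Im d * ?A))) (at z)"
      unfolding F_def
      by (intro has_derivative_diff has_derivative_mult_right has_derivative_of_real 1 2)
    moreover have "(\<lambda>d. complex_of_real (Re d * ?A + Im d * ?B)
        - \<i> * complex_of_real (Re d * ?B - Im d * ?A)) = (*) (Complex ?A (- ?B))"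
      by (auto simp: fun_eq_iff complex_eq_iff algebra_simps)
    ultimately have "(F has_field_derivative Complex ?A (- ?B)) (at z)"
      by (simp add: has_field_derivative_def)
    then show "F field_differentiable (at z within U)"
      using field_differentiable_at_within field_differentiable_def by blast
  qed
  from holomorphic_convex_primitive'[OF assms(3,2) this]
  obtain g where g: "\<And>x. x \<in> U \<Longrightarrow> (g has_field_derivative F x) (at x within U)" by blast
  have "((\<lambda>x. Re (g x) - u x) has_derivative (\<lambda>d. 0)) (at x within U)" if x: "x \<in> U" for x
  proof -
    have "(g has_derivative (*) (F x)) (at x within U)"
      using g[OF x] by (simp add: has_field_derivative_def)
    moreover have "(u has_derivative frechet_derivative u (at x)) (at x within U)"
      using du[OF x] frechet_derivative_works has_derivative_at_withinI by blast
    ultimately have "((\<lambda>x. Re (g x) - u x) has_derivative (\<lambda>d. Re (F x * d) - frechet_derivative u (at x) d)) (at x within U)"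
      by (rule has_derivative_diff[OF has_derivative_Re])
    moreover have "(\<lambda>d. Re (F x * d) - frechet_derivative u (at x) d) = (\<lambda>d. 0)"
      unfolding frechet_derivative_complex_direction[OF du[OF x]]
      by (auto simp: F_def fun_eq_iff algebra_simps)
    ultimately show ?thesis by simp
  qed
  then obtain c where c: "\<And>x. x \<in> U \<Longrightarrow> Re (g x) - u x = c"
    using has_derivative_zero_constant[OF assms(3), of "\<lambda>x. Re (g x) - u x"] by blast
  have "g holomorphic_on U"
    unfolding holomorphic_on_def using g field_differentiable_def by blast
  then show thesis
    by (intro that[of "\<lambda>z. g z - of_real c"]) (auto intro!: holomorphic_intros dest: c)
qed

text \<open>In this form the maximum principle becomes available for every scalar function \<open>f \<bullet> v\<close>.\<close>

lemma harmonic_map_inner_Re_holomorphic: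
  assumes "harmonic_map_on U f" "open U" "convex U"
  obtains h where "h holomorphic_on U" "\<And>z. z \<in> U \<Longrightarrow> Re (h z) = f z \<bullet> v"
proof -
  have "\<forall>k. \<exists>h. h holomorphic_on U \<and> (\<forall>z\<in>U. Re (h z) = f z $ k)"
    using assms harmonic_imp_Re_holomorphic unfolding harmonic_map_on_def by metis
  then obtain H where H: "\<And>k. H k holomorphic_on U" "\<And>k z. z \<in> U \<Longrightarrow> Re (H k z) = f z $ k"
    by metis
  show thesis
  proof (rule that[of "\<lambda>z. \<Sum>k\<in>UNIV. H k z * of_real (v $ k)"])
    show "(\<lambda>z. \<Sum>k\<in>UNIV. H k z * of_real (v $ k)) holomorphic_on U"
      by (intro holomorphic_intros H)
  qed (simp add: H inner_vec_def)
qed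

lemma harmonic_map_differentiable:
  assumes "harmonic_map_on U f" "z \<in> U"
  shows "f differentiable (at z)"
proof -
  have "(\<lambda>y. f y $ k) differentiable (at z)" for k
    using assms by (auto simp: harmonic_map_on_def harmonic_fun_on_def numeral_2_eq_2)
  then have "(\<lambda>y. f y \<bullet> b) differentiable (at z)" if "b \<in> Basis" for b
    using that by (auto simp: Basis_vec_def inner_axis)
  then show ?thesis
    using differentiable_componentwise_within[of f z UNIV] by blast
qed

lemma deriv_of_Re_eq_inner:
  fixes f :: "complex \<Rightarrow> 'a::real_inner"
  assumes "k holomorphic_on S" "open S" "\<And>\<zeta>. \<zeta> \<in> S \<Longrightarrow> Re (k \<zeta>) = f \<zeta> \<bullet> v"
    and f: "f differentiable (at w)" and w: "w \<in> S"
  shows "deriv k w = Complex (partial_x f w \<bullet> v) (- (partial_y f w \<bullet> v))"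
proof -
  let ?D = "frechet_derivative f (at w)"
  have "(k has_field_derivative deriv k w) (at w)"
    using assms holomorphic_derivI by blast
  then have "((\<lambda>\<zeta>. Re (k \<zeta>)) has_derivative (\<lambda>d. Re (deriv k w * d))) (at w)"
    by (intro has_derivative_Re) (simp add: has_field_derivative_def)
  moreover have "((\<lambda>\<zeta>. Re (k \<zeta>)) has_derivative (\<lambda>d. ?D d \<bullet> v)) (at w)"
  proof (rule has_derivative_transform_within_open[OF _ assms(2) w])
    show "((\<lambda>\<zeta>. f \<zeta> \<bullet> v) has_derivative (\<lambda>d. ?D d \<bullet> v)) (at w)"
      using f by (intro has_derivative_inner_left) (simp add: frechet_derivative_works[symmetric])
  qed (simp add: assms(3))
  ultimately have "(\<lambda>d. Re (deriv k w * d)) = (\<lambda>d. ?D d \<bullet> v)"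
    by (rule has_derivative_unique)
  from fun_cong[OF this, of 1] fun_cong[OF this, of \<i>] show ?thesis
    by (simp add: partial_x_def partial_y_def complex_eq_iff)
qed

section \<open>Maximum principle and products with first-order trigonometric functions\<close>

text \<open>This is the maximum modulus principle for \<open>exp (- h)\<close>, whose modulus is \<open>exp (- Re h)\<close>.\<close>

lemma Re_nonneg_from_sphere:
  assumes hol: "h holomorphic_on ball 0 \<rho>" and cont: "continuous_on (cball 0 \<rho>) h"
    and nonneg: "\<And>\<zeta>. norm \<zeta> = \<rho> \<Longrightarrow> 0 \<le> Re (h \<zeta>)"
    and "norm \<zeta> \<le> \<rho>"
  shows "0 \<le> Re (h \<zeta>)"
proof -
  have "norm (exp (- h \<zeta>)) \<le> 1"
  proof (rule maximum_modulus_frontier[where S = "cball 0 \<rho>" and f = "\<lambda>\<zeta>. exp (- h \<zeta>)"])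
    show "(\<lambda>\<zeta>. exp (- h \<zeta>)) holomorphic_on interior (cball 0 \<rho>)"
      using hol by (auto intro!: holomorphic_intros)
    show "continuous_on (closure (cball 0 \<rho>)) (\<lambda>\<zeta>. exp (- h \<zeta>))"
      using cont by (auto intro!: continuous_intros)
    show "norm (exp (- h z)) \<le> 1" if "z \<in> frontier (cball 0 \<rho>)" for z
      using that nonneg[of z] by simp
  qed (use assms in auto)
  then show ?thesis by simp
qed

text \<open>Here \<open>exp (- h)\<close> attains its maximal modulus \<open>1\<close> at the centre, so it is constant.\<close>

lemma Re_zero_if_nonneg_and_zero_at_centre:
  assumes hol: "h holomorphic_on ball 0 1"
    and nonneg: "\<And>\<zeta>. norm \<zeta> < 1 \<Longrightarrow> 0 \<le> Re (h \<zeta>)"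
    and "Re (h 0) = 0" "norm \<zeta> < 1"
  shows "Re (h \<zeta>) = 0"
proof -
  have "(\<lambda>\<zeta>. exp (- h \<zeta>)) constant_on ball 0 1"
    by (rule maximum_modulus_principle[where U = "ball 0 1" and \<xi> = 0])
      (use assms in \<open>auto intro!: holomorphic_intros\<close>)
  then obtain k where "\<And>\<zeta>. norm \<zeta> < 1 \<Longrightarrow> exp (- h \<zeta>) = k"
    by (auto simp: constant_on_def)
  from this[OF \<open>norm \<zeta> < 1\<close>] this[of 0] have "exp (- h \<zeta>) = exp (- h 0)" by simp
  then have "norm (exp (- h \<zeta>)) = norm (exp (- h 0))" by simp
  then show ?thesis using assms by simp
qed

text \<open>On the circle of radius \<open>\<rho>\<close> the product of \<open>Re h\<close> with the first-order trigonometric function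
\<open>Re (\<alpha> \<zeta> / \<rho>)\<close> is the real part of \<open>(\<alpha> h \<zeta> / \<rho> + cnj \<alpha> \<rho> h / \<zeta>) / 2\<close>, because there \<open>cnj (\<zeta> / \<rho>) = \<rho> / \<zeta>\<close>. The
second summand has a pole at the origin with residue proportional to \<open>h 0\<close>. Reflecting this polar
part, that is, replacing \<open>\<kappa> \<rho> / \<zeta>\<close> by \<open>cnj \<kappa> \<zeta> / \<rho>\<close>, preserves the real part on the circle and leaves a
holomorphic function. The real part of its value at the origin is the mean of the product over
the circle, which is a first Fourier coefficient of \<open>Re h\<close>.\<close>

definition twist :: "real \<Rightarrow> complex \<Rightarrow> (complex \<Rightarrow> complex) \<Rightarrow> complex \<Rightarrow> complex" where
  "twist \<rho> \<alpha> h \<zeta> = (\<alpha> * (h \<zeta> + cnj (h 0)) * (\<zeta> / of_real \<rho>)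
     + cnj \<alpha> * of_real \<rho> * (if \<zeta> = 0 then deriv h 0 else (h \<zeta> - h 0) / (\<zeta> - 0))) / 2"

lemma twist_holomorphic:
  assumes "h holomorphic_on S" "open S" "\<rho> \<noteq> 0"
  shows "twist \<rho> \<alpha> h holomorphic_on S"
proof -
  have "(\<lambda>\<zeta>. if \<zeta> = 0 then deriv h 0 else (h \<zeta> - h 0) / (\<zeta> - 0)) holomorphic_on S"
    by (rule pole_lemma_open[OF assms(1,2)])
  then show ?thesis
    unfolding twist_def[abs_def] using assms by (intro holomorphic_intros) auto
qed

lemma Re_twist_on_sphere:
  assumes "norm \<zeta> = \<rho>" "0 < \<rho>"
  shows "Re (twist \<rho> \<alpha> h \<zeta>) = Re (h \<zeta>) * Re (\<alpha> * (\<zeta> / of_real \<rho>))"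
proof -
  define \<omega> where "\<omega> = \<zeta> / of_real \<rho>"
  have \<zeta>: "\<zeta> = of_real \<rho> * \<omega>" "\<zeta> \<noteq> 0" using assms by (auto simp: \<omega>_def)
  have "norm \<omega> = 1" using assms by (simp add: \<omega>_def norm_divide)
  then have "\<omega> * cnj \<omega> = 1" using complex_norm_square[of \<omega>] by simp
  then have cnj: "cnj \<omega> = 1 / \<omega>"
    by (metis mult_zero_left nonzero_eq_divide_eq mult.commute zero_neq_one)
  have tw: "twist \<rho> \<alpha> h \<zeta> = (\<alpha> * (h \<zeta> + cnj (h 0)) * \<omega> + cnj \<alpha> * (h \<zeta> - h 0) * cnj \<omega>) / 2"
    using \<zeta> assms unfolding twist_def \<omega>_def[symmetric] cnj by (simp add: field_simps)
  show ?thesis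
    unfolding \<omega>_def[symmetric] tw by (simp add: field_simps)
qed

lemma Re_twist_0: "Re (twist \<rho> \<alpha> h 0) = \<rho> * Re (cnj \<alpha> * deriv h 0) / 2"
  by (simp add: twist_def algebra_simps)

lemma twist_tendsto [tendsto_intros]:
  assumes "(g \<longlongrightarrow> \<rho>) F" "\<rho> \<noteq> 0"
  shows "((\<lambda>x. twist (g x) \<alpha> h \<zeta>) \<longlongrightarrow> twist \<rho> \<alpha> h \<zeta>) F"
  unfolding twist_def using assms by (intro tendsto_intros) auto

section \<open>Moebius functions\<close>

lemma one_plus_cnj_mult_nonzero:
  assumes "norm a < 1" "norm \<omega> \<le> 1"
  shows "1 + cnj a * \<omega> \<noteq> 0"
proof
  assume "1 + cnj a * \<omega> = 0"
  then have "cnj a * \<omega> = - 1" by (simp add: add_eq_0_iff)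
  then have "norm a * norm \<omega> = 1" by (metis complex_mod_cnj norm_minus_cancel norm_mult norm_one)
  moreover have "norm a * norm \<omega> \<le> norm a * 1" using assms by (intro mult_left_mono) auto
  ultimately show False using assms by simp
qed

lemma Moebius_function_minus:
  "Moebius_function 0 (- a) \<omega> = (\<omega> + a) / (1 + cnj a * \<omega>)"
  by (simp add: Moebius_function_simple)

text \<open>The weight \<open>|1 + cnj a \<omega>|\<^sup>2\<close> clears the denominator: on the unit circle, the weight and its product with
the Moebius function are trigonometric polynomials of degree one, so that testing against them
involves only the value and the first derivative at the origin.\<close>

lemma Moebius_function_on_circle:
  assumes "norm a < 1" "norm \<omega> = 1"
  shows "of_real ((norm (1 + cnj a * \<omega>))\<^sup>2) * Moebius_function 0 (- a) \<omega> = \<omega> + 2 * a + a\<^sup>2 * cnj \<omega>"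
    and "norm (Moebius_function 0 (- a) \<omega>) = 1"
proof -
  have nz: "1 + cnj a * \<omega> \<noteq> 0" using one_plus_cnj_mult_nonzero assms by simp
  have 1: "\<omega> * cnj \<omega> = 1" using complex_norm_square[of \<omega>] assms by simp
  have "of_real ((norm (1 + cnj a * \<omega>))\<^sup>2) * Moebius_function 0 (- a) \<omega> = cnj (1 + cnj a * \<omega>) * (\<omega> + a)"
    using nz unfolding complex_norm_square Moebius_function_minus by simp
  also have "\<dots> = \<omega> + a + a * (\<omega> * cnj \<omega>) + a\<^sup>2 * cnj \<omega>"
    by (simp add: algebra_simps power2_eq_square)
  finally show "of_real ((norm (1 + cnj a * \<omega>))\<^sup>2) * Moebius_function 0 (- a) \<omega> = \<omega> + 2 * a + a\<^sup>2 * cnj \<omega>"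
    using 1 by simp
  have "\<omega> * cnj (1 + cnj a * \<omega>) = \<omega> + a * (\<omega> * cnj \<omega>)" by (simp add: algebra_simps)
  then have "norm \<omega> * norm (cnj (1 + cnj a * \<omega>)) = norm (\<omega> + a)"
    using 1 by (metis mult.right_neutral norm_mult)
  then have "norm (1 + cnj a * \<omega>) = norm (\<omega> + a)"
    using assms by (simp only: complex_mod_cnj mult_1)
  then show "norm (Moebius_function 0 (- a) \<omega>) = 1"
    using nz by (simp add: Moebius_function_minus norm_divide) (metis norm_eq_zero)
qed

lemma DERIV_Moebius_function:
  assumes "1 - cnj w * \<zeta> \<noteq> 0"
  shows "(Moebius_function 0 w has_field_derivative of_real (1 - (norm w)\<^sup>2) / (1 - cnj w * \<zeta>)\<^sup>2) (at \<zeta>)"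
proof -
  have der: "((\<lambda>\<zeta>. (\<zeta> - w) / (1 - cnj w * \<zeta>)) has_field_derivative
      ((1 - cnj w * \<zeta>) - (\<zeta> - w) * (- cnj w)) / ((1 - cnj w * \<zeta>) * (1 - cnj w * \<zeta>))) (at \<zeta>)"
    by (rule derivative_eq_intros refl assms | simp)+
  have num: "(1 - cnj w * \<zeta>) - (\<zeta> - w) * (- cnj w) = of_real (1 - (norm w)\<^sup>2)"
    unfolding of_real_diff complex_norm_square by (simp add: algebra_simps)
  show ?thesis
    using der unfolding num
    by (simp only: Moebius_function_simple[abs_def] power2_eq_square[of "1 - cnj w * \<zeta>"])
qed

lemma Moebius_function_inverse:
  assumes "norm a < 1" "norm \<zeta> < 1"
  shows "Moebius_function 0 a (Moebius_function 0 (- a) \<zeta>) = \<zeta>"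
    and "Moebius_function 0 (- a) (Moebius_function 0 a \<zeta>) = \<zeta>"
  using assms by (auto intro!: Moebius_function_compose)

lemma Moebius_function_0_eq: "Moebius_function 0 a 0 = - a"
  by (simp add: Moebius_function_of_zero)

section \<open>Isometric copies of the complex plane\<close>

definition plane_map :: "'a::real_vector \<Rightarrow> 'a \<Rightarrow> complex \<Rightarrow> 'a" where
  "plane_map e1 e2 w = Re w *\<^sub>R e1 + Im w *\<^sub>R e2"

lemma plane_map_inner_plane_map:
  assumes "norm e1 = 1" "norm e2 = 1" "e1 \<bullet> e2 = 0"
  shows "plane_map e1 e2 w \<bullet> plane_map e1 e2 w' = Re (cnj w * w')"
  using assms by (simp add: plane_map_def inner_add_left inner_add_right dot_square_norm inner_commute)

lemma norm_plane_map:
  assumes "norm e1 = 1" "norm e2 = 1" "e1 \<bullet> e2 = 0"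
  shows "norm (plane_map e1 e2 w) = norm w"
  unfolding norm_eq_sqrt_inner[of "plane_map e1 e2 w"] plane_map_inner_plane_map[OF assms]
  by (simp add: cmod_def power2_eq_square)

lemma bounded_linear_plane_map: "bounded_linear (plane_map e1 (e2 :: 'a::real_normed_vector))"
  unfolding plane_map_def[abs_def]
  by (rule bounded_linear_add[OF bounded_linear_compose[OF bounded_linear_scaleR_left bounded_linear_Re]
        bounded_linear_compose[OF bounded_linear_scaleR_left bounded_linear_Im]])

definition plane_coord :: "'a::real_inner \<Rightarrow> 'a \<Rightarrow> 'a \<Rightarrow> complex" where
  "plane_coord e1 e2 v = Complex (v \<bullet> e1) (v \<bullet> e2)"

lemma bounded_linear_plane_coord: "bounded_linear (plane_coord e1 e2)"
proof -
  have "plane_coord e1 e2 = (\<lambda>v. of_real (v \<bullet> e1) + \<i> * of_real (v \<bullet> e2))"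
    by (auto simp: plane_coord_def fun_eq_iff complex_eq_iff)
  moreover have of_real: "bounded_linear (\<lambda>v::'a. complex_of_real (v \<bullet> e))" for e
    by (rule bounded_linear_compose[OF bounded_linear_of_real bounded_linear_inner_left])
  ultimately show ?thesis
    using bounded_linear_add[OF of_real bounded_linear_compose[OF bounded_linear_mult_right[of \<i>] of_real]]
    by simp
qed

lemma plane_coord_plane_map:
  assumes "norm e1 = 1" "norm e2 = 1" "e1 \<bullet> e2 = 0" "p \<bullet> e1 = 0" "p \<bullet> e2 = 0"
  shows "plane_coord e1 e2 (p + plane_map e1 e2 w) = w"
  using assms
  by (simp add: plane_coord_def plane_map_def inner_add_left inner_add_right dot_square_norm inner_commute)

lemma onorm_scaled_plane_map:
  assumes on: "norm e1 = 1" "norm e2 = 1" "e1 \<bullet> e2 = 0" and "0 \<le> s"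
  shows "onorm (\<lambda>d. s *\<^sub>R plane_map e1 e2 d) = s"
proof (rule antisym)
  show "onorm (\<lambda>d. s *\<^sub>R plane_map e1 e2 d) \<le> s"
    using assms by (intro onorm_bound) (auto simp: norm_plane_map[OF on])
  have "bounded_linear (\<lambda>d. s *\<^sub>R plane_map e1 e2 d)"
    by (rule bounded_linear_compose[OF bounded_linear_scaleR_right bounded_linear_plane_map])
  from onorm[OF this, of 1] show "s \<le> onorm (\<lambda>d. s *\<^sub>R plane_map e1 e2 d)"
    using assms by (simp add: norm_plane_map[OF on])
qed

lemma affine_plane_Int_ball:
  assumes on: "norm e1 = 1" "norm e2 = 1" "e1 \<bullet> e2 = 0" and p: "p \<bullet> e1 = 0" "p \<bullet> e2 = 0"
    and c: "0 < c" "c\<^sup>2 + (norm p)\<^sup>2 = 1"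
  shows "(\<lambda>v. (p + plane_map e1 e2 b) + v) ` range (plane_map e1 e2) \<inter> ball 0 1
       = (\<lambda>w. p + plane_map e1 e2 w) ` ball 0 c"
proof -
  have pyth: "norm (p + plane_map e1 e2 w) < 1 \<longleftrightarrow> norm w < c" for w
  proof -
    have "(norm (p + plane_map e1 e2 w))\<^sup>2 = (norm p)\<^sup>2 + (norm (plane_map e1 e2 w))\<^sup>2"
      using p by (simp add: power2_norm_eq_inner inner_add_left inner_add_right inner_commute plane_map_def)
    then have "(norm (p + plane_map e1 e2 w))\<^sup>2 = 1 - c\<^sup>2 + (norm w)\<^sup>2"
      using c by (simp add: norm_plane_map[OF on])
    then have "(norm (p + plane_map e1 e2 w))\<^sup>2 < 1\<^sup>2 \<longleftrightarrow> (norm w)\<^sup>2 < c\<^sup>2" by simp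
    moreover have "x\<^sup>2 < y\<^sup>2 \<longleftrightarrow> x < y" if "0 \<le> x" "0 \<le> y" for x y :: real
      using power_mono_iff[of y x 2] that by (simp flip: not_le)
    ultimately show ?thesis using c by (metis norm_ge_zero less_imp_le zero_le_one)
  qed
  have add: "p + plane_map e1 e2 b + plane_map e1 e2 d = p + plane_map e1 e2 (b + d)" for d
    by (simp add: plane_map_def algebra_simps)
  show ?thesis
  proof (intro equalityI subsetI)
    fix y assume "y \<in> (\<lambda>v. (p + plane_map e1 e2 b) + v) ` range (plane_map e1 e2) \<inter> ball 0 1"
    then obtain d where "y = p + plane_map e1 e2 b + plane_map e1 e2 d" and "norm y < 1" by auto
    then have "y = p + plane_map e1 e2 (b + d)" "norm y < 1" by (simp_all only: add)
    then show "y \<in> (\<lambda>w. p + plane_map e1 e2 w) ` ball 0 c" using pyth by auto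
  next
    fix y assume "y \<in> (\<lambda>w. p + plane_map e1 e2 w) ` ball 0 c"
    then obtain w where w: "y = p + plane_map e1 e2 w" "norm w < c" by auto
    then have "norm y < 1" using pyth by simp
    moreover have "y = (p + plane_map e1 e2 b) + plane_map e1 e2 (w - b)" by (simp add: add w)
    ultimately show "y \<in> (\<lambda>v. (p + plane_map e1 e2 b) + v) ` range (plane_map e1 e2) \<inter> ball 0 1"
      by auto
  qed
qed

text \<open>The cosine of the angle is the ratio of the norm of the orthogonal projection of \<open>v\<close> to that of \<open>v\<close>;
the least angle is attained at the projection, or at any vector of the plane if the projection
vanishes.\<close>

lemma norm_sin_angle_to_plane:
  fixes v :: "'a::real_inner"
  assumes on: "norm e1 = 1" "norm e2 = 1" "e1 \<bullet> e2 = 0" and v: "v \<noteq> 0"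
  shows "(norm v)\<^sup>2 * (sin (angle_to_subspace v (range (plane_map e1 e2))))\<^sup>2
       = (norm v)\<^sup>2 - (norm (Complex (v \<bullet> e1) (v \<bullet> e2)))\<^sup>2"
proof -
  define b where "b = Complex (v \<bullet> e1) (v \<bullet> e2)"
  define m where "m = norm b / norm v"
  have ip: "v \<bullet> plane_map e1 e2 d = Re (cnj b * d)" for d
    by (simp add: plane_map_def b_def inner_add_right algebra_simps)
  note nm = norm_plane_map[OF on]
  have bv: "norm b \<le> norm v"
  proof -
    have "norm b * norm b = Re (cnj b * b)"
      by (simp add: cmod_def power2_eq_square)
    also have "\<dots> = v \<bullet> plane_map e1 e2 b" by (simp add: ip)
    also have "\<dots> \<le> norm v * norm b"
      using norm_cauchy_schwarz[of v "plane_map e1 e2 b"] by (simp add: nm)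
    finally show ?thesis by (cases "b = 0") auto
  qed
  have m: "0 \<le> m" "m \<le> 1" using bv v by (simp_all add: m_def)
  have 0: "plane_map e1 e2 d = 0 \<longleftrightarrow> d = 0" for d
    using nm[of d] by (metis norm_eq_zero)
  have "angle_to_subspace v (range (plane_map e1 e2)) = arccos m"
    unfolding angle_to_subspace_def
  proof (rule cInf_eq_minimum)
    define d where "d = (if b = 0 then 1 else b)"
    have "d \<noteq> 0" by (simp add: d_def)
    have "Re (cnj b * d) = norm b * norm d"
      by (simp add: d_def cmod_def power2_eq_square)
    then have "vec_angle v (plane_map e1 e2 d) = arccos m"
      using \<open>d \<noteq> 0\<close> v by (simp add: vec_angle_def ip nm m_def)
    then show "arccos m \<in> vec_angle v ` (range (plane_map e1 e2) - {0})"
      using \<open>d \<noteq> 0\<close> 0 by (intro image_eqI[of _ _ "plane_map e1 e2 d"]) auto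
  next
    fix y assume "y \<in> vec_angle v ` (range (plane_map e1 e2) - {0})"
    then obtain d where d: "d \<noteq> 0" "y = vec_angle v (plane_map e1 e2 d)" using 0 by auto
    have "Re (cnj b * d) \<le> norm b * norm d"
      using complex_Re_le_cmod[of "cnj b * d"] by (simp add: norm_mult)
    then have "Re (cnj b * d) / (norm v * norm d) \<le> (norm b * norm d) / (norm v * norm d)"
      by (rule divide_right_mono) simp
    then have 1: "Re (cnj b * d) / (norm v * norm d) \<le> m"
      using d by (simp add: m_def)
    have "- (norm b * norm d) \<le> Re (cnj b * d)"
      using abs_Re_le_cmod[of "cnj b * d"] by (simp add: norm_mult abs_le_iff)
    moreover have "norm b * norm d \<le> norm v * norm d" using bv by (simp add: mult_right_mono)
    ultimately have "- (norm v * norm d) \<le> Re (cnj b * d)" by linarith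
    then have 2: "- 1 \<le> Re (cnj b * d) / (norm v * norm d)"
      using v d by (simp add: le_divide_eq)
    show "arccos m \<le> y"
      using arccos_le_arccos[OF 2 1 m(2)] by (simp add: d(2) vec_angle_def ip nm)
  qed
  moreover have "(sin (arccos m))\<^sup>2 = 1 - m\<^sup>2"
    using m by (simp add: sin_squared_eq)
  ultimately show ?thesis using v by (simp add: b_def[symmetric] m_def field_simps)
qed

section \<open>Comparison with the conformal parametrisation of an affine disc\<close>

text \<open>The situation after moving the base point to the origin. The affine disc has centre \<open>p\<close>, the foot of
the perpendicular from the origin, and radius \<open>c\<close>; the orthonormal vectors \<open>e1\<close> and \<open>e2\<close> span its
direction, and \<open>c a\<close> is the coordinate of \<open>f 0\<close> in it. The functions \<open>hp\<close>, \<open>h1\<close>, \<open>h2\<close> represent the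
components of \<open>f\<close> along \<open>p\<close>, \<open>e1\<close>, \<open>e2\<close>, and the values of their derivatives are those
that result if the differential of \<open>f\<close> at the origin is \<open>r\<close> times the isometry that sends \<open>1\<close> to \<open>e1\<close>
and \<open>i\<close> to \<open>e2\<close>.\<close>

locale harmonic_disc_comparison =
  fixes f :: "complex \<Rightarrow> 'a::real_inner" and p e1 e2 :: 'a and a :: complex and c r :: real
    and hp h1 h2 :: "complex \<Rightarrow> complex"
  assumes f_ball: "\<And>\<zeta>. norm \<zeta> < 1 \<Longrightarrow> norm (f \<zeta>) < 1"
    and onb: "norm e1 = 1" "norm e2 = 1" "e1 \<bullet> e2 = 0"
    and p_orth: "p \<bullet> e1 = 0" "p \<bullet> e2 = 0"
    and c: "0 < c" "c\<^sup>2 + (norm p)\<^sup>2 = 1"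
    and a: "norm a < 1"
    and f0: "f 0 = p + plane_map e1 e2 (of_real c * a)"
    and hol: "hp holomorphic_on ball 0 1" "h1 holomorphic_on ball 0 1" "h2 holomorphic_on ball 0 1"
    and Re_hp: "\<And>\<zeta>. norm \<zeta> < 1 \<Longrightarrow> Re (hp \<zeta>) = f \<zeta> \<bullet> p"
    and Re_h1: "\<And>\<zeta>. norm \<zeta> < 1 \<Longrightarrow> Re (h1 \<zeta>) = f \<zeta> \<bullet> e1"
    and Re_h2: "\<And>\<zeta>. norm \<zeta> < 1 \<Longrightarrow> Re (h2 \<zeta>) = f \<zeta> \<bullet> e2"
    and deriv_0: "deriv hp 0 = 0" "deriv h1 0 = of_real r" "deriv h2 0 = - \<i> * of_real r"
begin

text \<open>The conformal parametrisation of the affine disc that agrees with \<open>f\<close> at the origin and whose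
differential there is a positive multiple of the isometry with images \<open>e1\<close> and \<open>e2\<close>; it sends the
unit circle into the unit sphere.\<close>

definition model :: "complex \<Rightarrow> 'a" where
  "model \<omega> = p + plane_map e1 e2 (of_real c * Moebius_function 0 (- a) \<omega>)"

text \<open>A holomorphic function of \<open>\<zeta>\<close> whose real part on the circle of radius \<open>\<rho>\<close> is
\<open>|1 + cnj a \<omega>|\<^sup>2 (1 - f \<zeta> \<bullet> model \<omega>)\<close> with \<open>\<omega> = \<zeta> / \<rho>\<close>: the weight is expanded as
\<open>1 + |a|\<^sup>2 + 2 Re (cnj a \<omega>)\<close>, and each product of a component of \<open>f\<close> with a trigonometric polynomial is
represented by \<^const>\<open>twist\<close>.\<close>

definition gap :: "real \<Rightarrow> complex \<Rightarrow> complex" where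
  "gap \<rho> \<zeta> = of_real (1 + (norm a)\<^sup>2) + 2 * cnj a * (\<zeta> / of_real \<rho>)
     - (of_real (1 + (norm a)\<^sup>2) * hp \<zeta> + twist \<rho> (2 * cnj a) hp \<zeta>)
     - of_real c * (of_real (2 * Re a) * h1 \<zeta> + twist \<rho> (1 + (cnj a)\<^sup>2) h1 \<zeta>
         + of_real (2 * Im a) * h2 \<zeta> + twist \<rho> (- \<i> * (1 - (cnj a)\<^sup>2)) h2 \<zeta>)"

lemma gap_holomorphic:
  assumes "\<rho> \<noteq> 0"
  shows "gap \<rho> holomorphic_on ball 0 1"
  unfolding gap_def[abs_def] using assms by (intro holomorphic_intros twist_holomorphic hol) auto

lemma gap_tendsto:
  assumes "(g \<longlongrightarrow> 1) F"
  shows "((\<lambda>x. gap (g x) \<zeta>) \<longlongrightarrow> gap 1 \<zeta>) F"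
  unfolding gap_def using assms by (intro tendsto_intros) auto

text \<open>The value at the origin is affine in \<open>r\<close>, and for \<open>\<rho> = 1\<close> it vanishes exactly when \<open>r\<close> is the value
attained by the model.\<close>

lemma Re_gap_0: "Re (gap \<rho> 0) = c * (c * (1 - (norm a)\<^sup>2) - \<rho> * r)"
proof -
  have i: "f 0 \<bullet> p = (norm p)\<^sup>2" "f 0 \<bullet> e1 = c * Re a" "f 0 \<bullet> e2 = c * Im a"
    using onb p_orth
    by (simp_all add: f0 plane_map_def inner_add_left inner_add_right dot_square_norm inner_commute)
  have n: "(norm a)\<^sup>2 = (Re a)\<^sup>2 + (Im a)\<^sup>2" by (simp add: cmod_power2)
  have "Re (gap \<rho> 0) = (1 + (norm a)\<^sup>2) * (1 - (norm p)\<^sup>2)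
      - c * (2 * c * ((Re a)\<^sup>2 + (Im a)\<^sup>2) + \<rho> * r)"
    using Re_hp[of 0] Re_h1[of 0] Re_h2[of 0]
    by (simp add: gap_def Re_twist_0 deriv_0 i field_simps power2_eq_square)
  also have "1 - (norm p)\<^sup>2 = c\<^sup>2" using c by simp
  finally show ?thesis unfolding n by (simp add: algebra_simps power2_eq_square)
qed

lemma Re_gap_on_sphere:
  assumes "norm \<zeta> = \<rho>" "0 < \<rho>" "\<rho> < 1"
  shows "Re (gap \<rho> \<zeta>) = (norm (1 + cnj a * (\<zeta> / of_real \<rho>)))\<^sup>2 * (1 - f \<zeta> \<bullet> model (\<zeta> / of_real \<rho>))"
proof -
  define \<omega> where "\<omega> = \<zeta> / of_real \<rho>"
  define w where "w = (norm (1 + cnj a * \<omega>))\<^sup>2"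
  define m where "m = Moebius_function 0 (- a) \<omega>"
  have \<zeta>: "norm \<zeta> < 1" using assms by simp
  have \<omega>: "norm \<omega> = 1" using assms by (simp add: \<omega>_def norm_divide)
  have w: "w = 1 + (norm a)\<^sup>2 + 2 * Re (cnj a * \<omega>)"
  proof -
    have "(norm (1 + x))\<^sup>2 = 1 + (norm x)\<^sup>2 + 2 * Re x" for x
      unfolding cmod_power2 by (simp add: algebra_simps power2_eq_square)
    then show ?thesis using \<omega> by (simp add: w_def norm_mult)
  qed
  have wm: "of_real w * m = \<omega> + 2 * a + a\<^sup>2 * cnj \<omega>"
    unfolding w_def m_def by (rule Moebius_function_on_circle(1)[OF a \<omega>])
  have "w * Re m = Re (of_real w * m)" "w * Im m = Im (of_real w * m)" by simp_all
  then have 1: "w * Re m = 2 * Re a + Re ((1 + (cnj a)\<^sup>2) * \<omega>)"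
    and 2: "w * Im m = 2 * Im a + Re (- \<i> * (1 - (cnj a)\<^sup>2) * \<omega>)"
    unfolding wm by (simp_all add: algebra_simps power2_eq_square)
  have "f \<zeta> \<bullet> model \<omega> = f \<zeta> \<bullet> p + c * (Re m * (f \<zeta> \<bullet> e1) + Im m * (f \<zeta> \<bullet> e2))"
    by (simp add: model_def plane_map_def m_def inner_add_right algebra_simps)
  then have "w * (1 - f \<zeta> \<bullet> model \<omega>)
      = w - w * (f \<zeta> \<bullet> p) - c * ((w * Re m) * (f \<zeta> \<bullet> e1) + (w * Im m) * (f \<zeta> \<bullet> e2))"
    by (simp add: algebra_simps)
  also have "\<dots> = Re (gap \<rho> \<zeta>)"
    unfolding 1 2 unfolding w gap_def \<omega>_def[symmetric]
    by (simp add: Re_twist_on_sphere[OF assms(1,2)] \<omega>_def[symmetric] Re_hp[OF \<zeta>] Re_h1[OF \<zeta>] Re_h2[OF \<zeta>] algebra_simps)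
  finally show ?thesis by (simp add: w_def \<omega>_def)
qed

lemma norm_model_on_circle:
  assumes "norm \<omega> = 1"
  shows "norm (model \<omega>) = 1"
proof -
  let ?v = "plane_map e1 e2 (of_real c * Moebius_function 0 (- a) \<omega>)"
  have "p \<bullet> ?v = 0" using p_orth by (simp add: plane_map_def inner_add_right)
  then have "(norm (model \<omega>))\<^sup>2 = (norm p)\<^sup>2 + (norm ?v)\<^sup>2"
    by (simp add: model_def power2_norm_eq_inner inner_add_left inner_add_right inner_commute)
  also have "norm ?v = c" using c a assms by (simp add: norm_plane_map[OF onb] norm_mult Moebius_function_on_circle)
  finally show ?thesis using c by (simp add: abs_square_eq_1 add.commute)
qed

text \<open>On the circle this is the Cauchy-Schwarz inequality for \<open>f \<zeta>\<close> in the ball and a unit vector.\<close>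

lemma Re_gap_nonneg:
  assumes "0 < \<rho>" "\<rho> < 1" "norm \<zeta> \<le> \<rho>"
  shows "0 \<le> Re (gap \<rho> \<zeta>)"
proof (rule Re_nonneg_from_sphere[OF _ _ _ assms(3)])
  have hg: "gap \<rho> holomorphic_on ball 0 1" using assms by (intro gap_holomorphic) auto
  show "gap \<rho> holomorphic_on ball 0 \<rho>"
    by (rule holomorphic_on_subset[OF hg]) (use assms in auto)
  show "continuous_on (cball 0 \<rho>) (gap \<rho>)"
    by (rule holomorphic_on_imp_continuous_on[OF holomorphic_on_subset[OF hg]]) (use assms in auto)
  fix \<zeta> :: complex assume \<zeta>: "norm \<zeta> = \<rho>"
  have "norm (\<zeta> / of_real \<rho>) = 1" using \<zeta> assms by (simp add: norm_divide)
  then have "f \<zeta> \<bullet> model (\<zeta> / of_real \<rho>) \<le> norm (f \<zeta>) * 1"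
    using norm_cauchy_schwarz[of "f \<zeta>"] norm_model_on_circle by metis
  also have "\<dots> \<le> 1" using f_ball[of \<zeta>] \<zeta> assms by simp
  finally show "0 \<le> Re (gap \<rho> \<zeta>)" unfolding Re_gap_on_sphere[OF \<zeta> assms(1,2)] by simp
qed

lemma eventually_radius: "\<forall>\<^sub>F \<rho> in at_left (1::real). b < \<rho> \<and> \<rho> < 1" if "b < 1" for b
  using that by (simp add: eventually_at_left_field) (meson that)

lemma radius_bound: "r \<le> c * (1 - (norm a)\<^sup>2)"
proof -
  have "((\<lambda>\<rho>. Re (gap \<rho> 0)) \<longlongrightarrow> Re (gap 1 0)) (at_left 1)"
    by (intro tendsto_Re gap_tendsto tendsto_ident_at)
  moreover have "\<forall>\<^sub>F \<rho> in at_left 1. 0 \<le> Re (gap \<rho> 0)"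
    using eventually_radius[of 0] by (auto elim!: eventually_mono intro!: Re_gap_nonneg)
  ultimately have "0 \<le> Re (gap 1 0)"
    by (intro tendsto_lowerbound[where F = "at_left (1::real)"]) auto
  then show ?thesis using c by (simp add: Re_gap_0 zero_le_mult_iff)
qed

text \<open>Equality forces the nonnegative harmonic function \<open>Re (gap 1)\<close> to vanish at the origin, hence everywhere.
On circles, \<open>gap\<close> controls \<open>|f \<zeta> - model \<omega>|\<^sup>2\<close>. The squared norm is a supremum of affine functions,
\<open>|F|\<^sup>2 \<ge> 2 F \<bullet> v - |v|\<^sup>2\<close>, and each of these is harmonic in \<open>\<zeta>\<close>, so that the estimate passes from the circle
to its interior for every fixed \<open>v\<close>. In the limit \<open>\<rho> \<longlonglongrightarrow> 1\<close>, the choice \<open>v = f \<zeta> - model \<zeta>\<close> gives the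
claim.\<close>

lemma equality_imp_model:
  assumes eq: "r = c * (1 - (norm a)\<^sup>2)"
    and harm: "\<And>v. \<exists>k. k holomorphic_on ball 0 1 \<and> (\<forall>\<zeta>. norm \<zeta> < 1 \<longrightarrow> Re (k \<zeta>) = f \<zeta> \<bullet> v)"
    and \<zeta>: "norm \<zeta> < 1"
  shows "f \<zeta> = model \<zeta>"
proof -
  have gap0: "Re (gap 1 \<zeta>) = 0"
  proof (rule Re_zero_if_nonneg_and_zero_at_centre[OF gap_holomorphic _ _ \<zeta>])
    show "0 \<le> Re (gap 1 \<xi>)" if "norm \<xi> < 1" for \<xi>
    proof (rule tendsto_lowerbound)
      show "((\<lambda>\<rho>. Re (gap \<rho> \<xi>)) \<longlongrightarrow> Re (gap 1 \<xi>)) (at_left 1)"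
        by (intro tendsto_Re gap_tendsto tendsto_ident_at)
      show "\<forall>\<^sub>F \<rho> in at_left 1. 0 \<le> Re (gap \<rho> \<xi>)"
        using eventually_radius[OF that]
        by (rule eventually_mono) (auto intro!: Re_gap_nonneg elim: order.strict_trans1[OF norm_ge_zero])
    qed auto
  qed (simp_all add: Re_gap_0 eq)
  define v where "v = f \<zeta> - model \<zeta>"
  obtain k where k: "k holomorphic_on ball 0 1" "\<And>\<zeta>. norm \<zeta> < 1 \<Longrightarrow> Re (k \<zeta>) = f \<zeta> \<bullet> v"
    using harm[of v] by blast
  \<comment> \<open>A lower bound of the weight on the unit circle.\<close>
  define w0 where "w0 = (1 - norm a)\<^sup>2"
  have w0: "0 < w0" using a by (simp add: w0_def)
  define M where "M = (\<lambda>\<omega>. of_real (p \<bullet> v) + of_real c * Moebius_function 0 (- a) \<omega> * Complex (e1 \<bullet> v) (- (e2 \<bullet> v)))"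
  have Re_M: "Re (M \<omega>) = model \<omega> \<bullet> v" for \<omega>
    by (simp add: M_def model_def plane_map_def inner_add_left algebra_simps)
  \<comment> \<open>Nonnegative real part says \<open>2 (f \<xi> - model (\<xi> / \<rho>)) \<bullet> v - |v|\<^sup>2 \<le> (2 / w0) Re (gap \<rho> \<xi>)\<close>.\<close>
  define Q where "Q = (\<lambda>\<rho> \<xi>. of_real (2 / w0) * gap \<rho> \<xi> - 2 * (k \<xi> - M (\<xi> / of_real \<rho>)) + of_real ((norm v)\<^sup>2))"
  have Q: "0 \<le> Re (Q \<rho> \<zeta>)" if \<rho>: "norm \<zeta> < \<rho>" "\<rho> < 1" for \<rho>
  proof (rule Re_nonneg_from_sphere[where h = "Q \<rho>"])
    have \<rho>0: "0 < \<rho>" using \<rho> by (meson norm_ge_zero order.strict_trans1)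
    have nz: "1 + cnj a * (\<xi> / of_real \<rho>) \<noteq> 0" if "norm \<xi> \<le> \<rho>" for \<xi>
      using that \<rho>0 a by (intro one_plus_cnj_mult_nonzero) (auto simp: norm_divide)
    have hg: "gap \<rho> holomorphic_on ball 0 1" using \<rho>0 by (intro gap_holomorphic) auto
    have sub: "ball (0::complex) \<rho> \<subseteq> ball 0 1" "cball (0::complex) \<rho> \<subseteq> ball 0 1" using \<rho> by auto
    note h1 = holomorphic_on_subset[OF hg sub(1)] holomorphic_on_subset[OF k(1) sub(1)]
    note c1 = holomorphic_on_imp_continuous_on[OF holomorphic_on_subset[OF hg sub(2)]]
      holomorphic_on_imp_continuous_on[OF holomorphic_on_subset[OF k(1) sub(2)]]
    show "Q \<rho> holomorphic_on ball 0 \<rho>"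
      unfolding Q_def M_def Moebius_function_minus
      by (intro holomorphic_intros h1) (use nz \<rho>0 in auto)
    show "continuous_on (cball 0 \<rho>) (Q \<rho>)"
      unfolding Q_def M_def Moebius_function_minus
      by (intro continuous_intros c1) (use nz \<rho>0 in auto)
    show "norm \<zeta> \<le> \<rho>" using \<rho> by simp
    fix \<xi> :: complex assume \<xi>: "norm \<xi> = \<rho>"
    define \<omega> where "\<omega> = \<xi> / of_real \<rho>"
    have \<omega>: "norm \<omega> = 1" using \<xi> \<rho>0 by (simp add: \<omega>_def norm_divide)
    have \<xi>1: "norm \<xi> < 1" using \<xi> \<rho> by simp
    define F where "F = f \<xi> - model \<omega>"
    have "(norm F)\<^sup>2 = (norm (f \<xi>))\<^sup>2 + (norm (model \<omega>))\<^sup>2 - 2 * (f \<xi> \<bullet> model \<omega>)"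
      by (simp add: F_def power2_norm_eq_inner inner_diff_left inner_diff_right inner_commute)
    moreover have "(norm (f \<xi>))\<^sup>2 \<le> 1" using f_ball[OF \<xi>1] by (simp add: power_le_one)
    ultimately have F: "(norm F)\<^sup>2 \<le> 2 * (1 - f \<xi> \<bullet> model \<omega>)"
      by (simp add: norm_model_on_circle[OF \<omega>])
    have "1 - norm a \<le> norm (1 + cnj a * \<omega>)"
      using norm_diff_ineq[of 1 "cnj a * \<omega>"] \<omega> by (simp add: norm_mult)
    then have "w0 \<le> (norm (1 + cnj a * \<omega>))\<^sup>2"
      unfolding w0_def using a by (intro power_mono) auto
    moreover have "0 \<le> 1 - f \<xi> \<bullet> model \<omega>" using order_trans[OF zero_le_power2 F] by simp
    ultimately have "w0 * (1 - f \<xi> \<bullet> model \<omega>) \<le> Re (gap \<rho> \<xi>)"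
      unfolding Re_gap_on_sphere[OF \<xi> \<rho>0 \<rho>(2)] \<omega>_def by (intro mult_right_mono)
    then have "2 * (1 - f \<xi> \<bullet> model \<omega>) \<le> 2 / w0 * Re (gap \<rho> \<xi>)"
      using w0 by (simp add: field_simps)
    with F have "(norm F)\<^sup>2 \<le> 2 / w0 * Re (gap \<rho> \<xi>)" by linarith
    moreover have "0 \<le> (norm (F - v))\<^sup>2" by simp
    then have "2 * (F \<bullet> v) \<le> (norm F)\<^sup>2 + (norm v)\<^sup>2"
      unfolding power2_norm_eq_inner by (simp add: inner_diff_left inner_diff_right inner_commute)
    ultimately show "0 \<le> Re (Q \<rho> \<xi>)"
      using k(2)[OF \<xi>1] by (simp add: Q_def Re_M \<omega>_def[symmetric] F_def inner_diff_left)
  qed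
  have "0 \<le> Re (Q 1 \<zeta>)"
  proof (rule tendsto_lowerbound)
    have "1 + cnj a * (\<zeta> / of_real 1) \<noteq> 0" using a \<zeta> by (simp add: one_plus_cnj_mult_nonzero)
    then show "((\<lambda>\<rho>. Re (Q \<rho> \<zeta>)) \<longlongrightarrow> Re (Q 1 \<zeta>)) (at_left 1)"
      unfolding Q_def M_def Moebius_function_minus
      by (intro tendsto_intros gap_tendsto) auto
    show "\<forall>\<^sub>F \<rho> in at_left 1. 0 \<le> Re (Q \<rho> \<zeta>)"
      using eventually_radius[OF \<zeta>] by (rule eventually_mono) (auto intro!: Q)
  qed auto
  then have "(norm v)\<^sup>2 \<le> 0"
    using gap0 k(2)[OF \<zeta>]
    by (simp add: Q_def Re_M v_def[symmetric] power2_norm_eq_inner) (simp add: v_def inner_diff_left)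
  then show ?thesis by (simp add: v_def)
qed

end

section \<open>Affine discs as conformal images\<close>

lemma Ck_on_cong:
  assumes "open U" "\<And>x. x \<in> U \<Longrightarrow> f x = g x" "Ck_on k U f"
  shows "Ck_on k U g"
  using assms(2,3)
proof (induction k arbitrary: f g)
  case 0
  then show ?case using continuous_on_cong by fastforce
next
  case (Suc k)
  have df: "f differentiable (at x)" if "x \<in> U" for x using Suc.prems(2) that by simp
  have "frechet_derivative f (at x) = frechet_derivative g (at x)" if "x \<in> U" for x
    using frechet_derivative_transform_within_open[OF df[OF that] assms(1) that] Suc.prems(1) by blast
  then have "Ck_on k U (\<lambda>x. frechet_derivative g (at x) v)" for v
    using Suc.IH[of "\<lambda>x. frechet_derivative f (at x) v" "\<lambda>x. frechet_derivative g (at x) v"] Suc.prems(2)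
    by simp
  moreover have "g differentiable (at x)" if "x \<in> U" for x
    using df[OF that] Suc.prems(1) that assms(1) unfolding differentiable_def
    by (meson has_derivative_transform_within_open)
  ultimately show ?case by simp
qed

text \<open>Maps of this form are closed under differentiation in a fixed direction \<open>v\<close>, which replaces the
holomorphic factor by \<open>\<lambda>w. deriv F w * \<pi> v\<close>; hence the induction over all \<open>F\<close> at once. The two linear
maps make the lemma apply both to the parametrisation of an affine disc and to its inverse, extended
to a neighbourhood in the ambient space.\<close>

lemma Ck_on_linear_holomorphic_linear:
  fixes \<pi> :: "'a::euclidean_space \<Rightarrow> complex" and \<iota> :: "complex \<Rightarrow> 'b::euclidean_space"
  assumes lin: "bounded_linear \<pi>" "bounded_linear \<iota>" and V: "open V" and F: "F holomorphic_on V"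
  shows "Ck_on k (\<pi> -` V) (\<lambda>y. q + \<iota> (F (\<pi> y)))"
  using F
proof (induction k arbitrary: F q)
  case 0
  interpret \<pi>: bounded_linear \<pi> by fact
  interpret \<iota>: bounded_linear \<iota> by fact
  have "continuous_on (\<pi> -` V) (\<lambda>y. F (\<pi> y))"
    by (rule continuous_on_compose2[OF holomorphic_on_imp_continuous_on[OF 0] \<pi>.continuous_on]) auto
  then show ?case by (auto intro!: continuous_intros \<iota>.continuous_on)
next
  case (Suc k)
  have opn: "open (\<pi> -` V)"
    using V lin(1) by (simp add: continuous_open_vimage linear_continuous_at)
  have D: "((\<lambda>y. q + \<iota> (F (\<pi> y))) has_derivative (\<lambda>v. \<iota> (deriv F (\<pi> y) * \<pi> v))) (at y)"
    if y: "\<pi> y \<in> V" for y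
  proof -
    have F': "(F has_derivative (*) (deriv F (\<pi> y))) (at (\<pi> y))"
      using holomorphic_derivI[OF Suc.prems V y] by (simp add: has_field_derivative_def)
    have "((\<lambda>y. F (\<pi> y)) has_derivative (\<lambda>v. deriv F (\<pi> y) * \<pi> v)) (at y)"
      by (rule has_derivative_compose[OF bounded_linear_imp_has_derivative[OF lin(1)] F'])
    then have "((\<lambda>y. q + \<iota> (F (\<pi> y))) has_derivative (\<lambda>v. 0 + \<iota> (deriv F (\<pi> y) * \<pi> v))) (at y)"
      by (intro has_derivative_add has_derivative_const bounded_linear.has_derivative[OF lin(2)])
    then show ?thesis by simp
  qed
  have "Ck_on k (\<pi> -` V) (\<lambda>y. frechet_derivative (\<lambda>y. q + \<iota> (F (\<pi> y))) (at y) v)" for v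
  proof (rule Ck_on_cong[OF opn])
    show "Ck_on k (\<pi> -` V) (\<lambda>y. 0 + \<iota> (deriv F (\<pi> y) * \<pi> v))"
      by (rule Suc.IH) (intro holomorphic_intros Suc.prems V)
    show "0 + \<iota> (deriv F (\<pi> y) * \<pi> v) = frechet_derivative (\<lambda>y. q + \<iota> (F (\<pi> y))) (at y) v"
      if "y \<in> \<pi> -` V" for y
      using frechet_derivative_at[OF D[of y]] that by (simp add: fun_eq_iff)
  qed
  moreover have "(\<lambda>y. q + \<iota> (F (\<pi> y))) differentiable (at y)" if "y \<in> \<pi> -` V" for y
    using D[of y] that differentiable_def by blast
  ultimately show ?case by simp
qed

lemma conformal_diffeomorphism_onto_affine_disc:
  fixes f :: "complex \<Rightarrow> real ^ 'n"
  assumes on: "norm e1 = 1" "norm e2 = 1" "e1 \<bullet> e2 = 0" and p: "p \<bullet> e1 = 0" "p \<bullet> e2 = 0"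
    and hol: "\<phi> holomorphic_on ball 0 1" "\<psi> holomorphic_on ball 0 c"
    and maps: "\<And>\<zeta>. norm \<zeta> < 1 \<Longrightarrow> norm (\<phi> \<zeta>) < c" "\<And>w. norm w < c \<Longrightarrow> norm (\<psi> w) < 1"
    and inv: "\<And>\<zeta>. norm \<zeta> < 1 \<Longrightarrow> \<psi> (\<phi> \<zeta>) = \<zeta>" "\<And>w. norm w < c \<Longrightarrow> \<phi> (\<psi> w) = w"
    and f: "\<And>\<zeta>. norm \<zeta> < 1 \<Longrightarrow> f \<zeta> = p + plane_map e1 e2 (\<phi> \<zeta>)"
  shows "conformal_diffeomorphism_onto f (ball 0 1) ((\<lambda>w. p + plane_map e1 e2 w) ` ball 0 c)"
proof -
  let ?\<Sigma> = "(\<lambda>w. p + plane_map e1 e2 w) ` ball 0 c"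
  note coord = plane_coord_plane_map[OF on p]
  have inj: "inj_on f (ball 0 1)"
  proof (rule inj_onI)
    fix x y assume xy: "x \<in> ball 0 1" "y \<in> ball 0 1" "f x = f y"
    have "plane_coord e1 e2 (f \<zeta>) = \<phi> \<zeta>" if "norm \<zeta> < 1" for \<zeta>
      using that by (simp add: f coord)
    then have "\<phi> x = \<phi> y" using xy by (metis mem_ball_0)
    moreover have "\<psi> (\<phi> x) = x" "\<psi> (\<phi> y) = y" using inv(1) xy(1,2) by simp_all
    ultimately show "x = y" by metis
  qed
  have img: "f ` ball 0 1 = ?\<Sigma>"
  proof
    show "f ` ball 0 1 \<subseteq> ?\<Sigma>" using f maps(1) by auto
    show "?\<Sigma> \<subseteq> f ` ball 0 1"
    proof
      fix y assume "y \<in> ?\<Sigma>"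
      then obtain w where w: "norm w < c" "y = p + plane_map e1 e2 w" by auto
      then have "y = f (\<psi> w)" using f maps(2) inv(2) by simp
      then show "y \<in> f ` ball 0 1" using maps(2) w by auto
    qed
  qed
  have "smooth_map_on (ball 0 1) f"
    unfolding smooth_map_on_def
  proof
    fix x :: complex assume "x \<in> ball 0 1"
    have "Ck_on k (ball 0 1) (\<lambda>\<zeta>. p + plane_map e1 e2 (\<phi> \<zeta>))" for k
      using Ck_on_linear_holomorphic_linear[OF bounded_linear_ident bounded_linear_plane_map open_ball hol(1)]
      by simp
    then show "\<exists>U g. open U \<and> x \<in> U \<and> (\<forall>k. Ck_on k U g) \<and> (\<forall>y\<in>ball 0 1 \<inter> U. g y = f y)"
      using \<open>x \<in> ball 0 1\<close> f
      by (intro exI[of _ "ball 0 1"] exI[of _ "\<lambda>\<zeta>. p + plane_map e1 e2 (\<phi> \<zeta>)"]) auto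
  qed
  moreover have "smooth_map_on ?\<Sigma> (inv_into (ball 0 1) f)"
    unfolding smooth_map_on_def
  proof
    fix x assume x: "x \<in> ?\<Sigma>"
    let ?\<pi> = "plane_coord e1 e2"
    have Ck: "Ck_on k (?\<pi> -` ball 0 c) (\<lambda>y. 0 + \<psi> (?\<pi> y))" for k
      by (rule Ck_on_linear_holomorphic_linear[OF bounded_linear_plane_coord bounded_linear_ident open_ball hol(2)])
    have "open (?\<pi> -` ball 0 c)"
      by (simp add: continuous_open_vimage linear_continuous_at bounded_linear_plane_coord)
    moreover have "x \<in> ?\<pi> -` ball 0 c" using x by (auto simp: coord)
    moreover have "0 + \<psi> (?\<pi> y) = inv_into (ball 0 1) f y" if y: "y \<in> ?\<Sigma>" for y
    proof -
      obtain w where w: "norm w < c" "y = p + plane_map e1 e2 w" using y by auto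
      then have "y = f (\<psi> w)" "\<psi> w \<in> ball 0 1" using f maps(2) inv(2) by simp_all
      then show ?thesis using inv_into_f_f[OF inj] by (simp add: w(2) coord) (metis w(2) coord)
    qed
    ultimately show "\<exists>U g. open U \<and> x \<in> U \<and> (\<forall>k. Ck_on k U g)
        \<and> (\<forall>y\<in>?\<Sigma> \<inter> U. g y = inv_into (ball 0 1) f y)"
      using Ck by (intro exI[of _ "?\<pi> -` ball 0 c"] exI[of _ "\<lambda>y. 0 + \<psi> (?\<pi> y)"]) blast
  qed
  moreover have "conformal_at f w" if w: "w \<in> ball 0 1" for w
  proof -
    have "(\<phi> has_derivative (*) (deriv \<phi> w)) (at w)"
      using holomorphic_derivI[OF hol(1) open_ball w] by (simp add: has_field_derivative_def)
    then have "((\<lambda>\<zeta>. p + plane_map e1 e2 (\<phi> \<zeta>)) has_derivative (\<lambda>d. 0 + plane_map e1 e2 (deriv \<phi> w * d))) (at w)"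
      by (intro has_derivative_add has_derivative_const bounded_linear.has_derivative[OF bounded_linear_plane_map])
    then have "(f has_derivative (\<lambda>d. 0 + plane_map e1 e2 (deriv \<phi> w * d))) (at w)"
      by (rule has_derivative_transform_within_open[OF _ open_ball w]) (simp add: f)
    then have D: "frechet_derivative f (at w) = (\<lambda>d. 0 + plane_map e1 e2 (deriv \<phi> w * d))"
      by (rule frechet_derivative_at[symmetric])
    show ?thesis
      unfolding conformal_at_def partial_x_def partial_y_def D
      by (simp add: norm_plane_map[OF on] plane_map_inner_plane_map[OF on] norm_mult)
  qed
  ultimately show ?thesis
    using inj img by (simp add: conformal_diffeomorphism_onto_def diffeomorphism_onto_def bij_betw_def)
qed

section \<open>Conformal points of harmonic maps of the disc\<close>

text \<open>The data at an arbitrary point \<open>z\<close> where the differential is conformal and nonzero; \<open>s\<close> is its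
operator norm.\<close>

locale conformal_harmonic_disc =
  fixes f :: "complex \<Rightarrow> real ^ 'n" and z :: complex and p e1 e2 :: "real ^ 'n"
    and a :: complex and c s :: real
  assumes harmonic: "harmonic_map_on (ball 0 1) f"
    and f_ball: "\<And>\<zeta>. norm \<zeta> < 1 \<Longrightarrow> norm (f \<zeta>) < 1"
    and z: "norm z < 1"
    and onb: "norm e1 = 1" "norm e2 = 1" "e1 \<bullet> e2 = 0"
    and p_orth: "p \<bullet> e1 = 0" "p \<bullet> e2 = 0"
    and c: "0 < c" "c\<^sup>2 + (norm p)\<^sup>2 = 1"
    and a: "norm a < 1"
    and fz: "f z = p + plane_map e1 e2 (of_real c * a)"
    and s: "0 < s"
    and partials: "partial_x f z = s *\<^sub>R e1" "partial_y f z = s *\<^sub>R e2"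
begin

abbreviation "affine_disc \<equiv> (\<lambda>w. p + plane_map e1 e2 w) ` ball 0 c"

lemma f_differentiable: "norm w < 1 \<Longrightarrow> f differentiable (at w)"
  using harmonic_map_differentiable[OF harmonic] by simp

lemma inner_f:
  obtains k where "k holomorphic_on ball 0 1" "\<And>\<zeta>. norm \<zeta> < 1 \<Longrightarrow> Re (k \<zeta>) = f \<zeta> \<bullet> v"
    "\<And>w. norm w < 1 \<Longrightarrow> deriv k w = Complex (partial_x f w \<bullet> v) (- (partial_y f w \<bullet> v))"
proof -
  obtain k where k: "k holomorphic_on ball 0 1" "\<And>\<zeta>. \<zeta> \<in> ball 0 1 \<Longrightarrow> Re (k \<zeta>) = f \<zeta> \<bullet> v"
    using harmonic_map_inner_Re_holomorphic[OF harmonic open_ball convex_ball] by blast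
  show thesis
    by (rule that[OF k(1)]) (auto simp: k(2) intro!: deriv_of_Re_eq_inner[OF k(1) open_ball k(2)] f_differentiable)
qed

text \<open>The automorphism of the disc that moves \<open>0\<close> to \<open>z\<close> has the positive derivative \<open>1 - |z|\<^sup>2\<close> at \<open>0\<close>. So it
multiplies the norm of the differential by this factor and keeps \<open>e1\<close> and \<open>e2\<close>.\<close>

lemma bound_and_equality_case:
  shows "s * (1 - (norm z)\<^sup>2) \<le> c * (1 - (norm a)\<^sup>2)"
    and "s * (1 - (norm z)\<^sup>2) = c * (1 - (norm a)\<^sup>2) \<Longrightarrow>
      conformal_diffeomorphism_onto f (ball 0 1) affine_disc"
proof -
  let ?M = "Moebius_function 0 (- z)"
  have M_holo: "?M holomorphic_on ball 0 1" by (rule Moebius_function_holomorphic) (simp add: z)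
  have M_ball: "norm (?M \<zeta>) < 1" if "norm \<zeta> < 1" for \<zeta>
    using Moebius_function_norm_lt_1[of "- z" \<zeta>] z that by simp
  have M_0: "?M 0 = z" by (simp add: Moebius_function_0_eq)
  have M': "(?M has_field_derivative of_real (1 - (norm z)\<^sup>2)) (at 0)"
    using DERIV_Moebius_function[of "- z" 0] by simp
  have comp_holo: "(\<lambda>\<zeta>. k (?M \<zeta>)) holomorphic_on ball 0 1" if "k holomorphic_on ball 0 1" for k
    using holomorphic_on_compose_gen[OF M_holo that] M_ball by (simp add: o_def image_subset_iff)
  have comp_deriv: "deriv (\<lambda>\<zeta>. k (?M \<zeta>)) 0 = deriv k z * of_real (1 - (norm z)\<^sup>2)"
    if "k holomorphic_on ball 0 1" for k
  proof -
    have "(k has_field_derivative deriv k z) (at (?M 0))"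
      unfolding M_0 using holomorphic_derivI[OF that open_ball, of z] z by simp
    from DERIV_chain2[OF this M'] show ?thesis by (rule DERIV_imp_deriv)
  qed
  obtain kp where kp: "kp holomorphic_on ball 0 1" "\<And>\<zeta>. norm \<zeta> < 1 \<Longrightarrow> Re (kp \<zeta>) = f \<zeta> \<bullet> p"
    "deriv kp z = Complex (partial_x f z \<bullet> p) (- (partial_y f z \<bullet> p))"
    using inner_f[of p] z by metis
  obtain k1 where k1: "k1 holomorphic_on ball 0 1" "\<And>\<zeta>. norm \<zeta> < 1 \<Longrightarrow> Re (k1 \<zeta>) = f \<zeta> \<bullet> e1"
    "deriv k1 z = Complex (partial_x f z \<bullet> e1) (- (partial_y f z \<bullet> e1))"
    using inner_f[of e1] z by metis
  obtain k2 where k2: "k2 holomorphic_on ball 0 1" "\<And>\<zeta>. norm \<zeta> < 1 \<Longrightarrow> Re (k2 \<zeta>) = f \<zeta> \<bullet> e2"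
    "deriv k2 z = Complex (partial_x f z \<bullet> e2) (- (partial_y f z \<bullet> e2))"
    using inner_f[of e2] z by metis
  interpret C: harmonic_disc_comparison "\<lambda>\<zeta>. f (?M \<zeta>)" p e1 e2 a c "s * (1 - (norm z)\<^sup>2)"
    "\<lambda>\<zeta>. kp (?M \<zeta>)" "\<lambda>\<zeta>. k1 (?M \<zeta>)" "\<lambda>\<zeta>. k2 (?M \<zeta>)"
  proof (unfold_locales, goal_cases)
    case (1 \<zeta>)
    then show ?case by (intro f_ball M_ball)
  next
    case 10
    then show ?case by (simp add: M_0 fz)
  next
    case 11
    then show ?case by (intro comp_holo kp)
  next
    case 12
    then show ?case by (intro comp_holo k1)
  next
    case 13
    then show ?case by (intro comp_holo k2)
  next
    case (14 \<zeta>)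
    then show ?case by (intro kp M_ball)
  next
    case (15 \<zeta>)
    then show ?case by (intro k1 M_ball)
  next
    case (16 \<zeta>)
    then show ?case by (intro k2 M_ball)
  next
    case 17
    have "deriv kp z = 0"
      using p_orth by (simp add: kp(3) partials complex_eq_iff inner_commute)
    then show ?case by (simp add: comp_deriv[OF kp(1)])
  next
    case 18
    have "deriv k1 z = of_real s"
      using onb by (simp add: k1(3) partials complex_eq_iff inner_commute dot_square_norm)
    then show ?case by (simp add: comp_deriv[OF k1(1)])
  next
    case 19
    have "deriv k2 z = - \<i> * of_real s"
      using onb by (simp add: k2(3) partials complex_eq_iff inner_commute dot_square_norm)
    then show ?case by (simp add: comp_deriv[OF k2(1)])
  qed (use onb p_orth c a in auto)
  show "s * (1 - (norm z)\<^sup>2) \<le> c * (1 - (norm a)\<^sup>2)" by (rule C.radius_bound)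
  assume eq: "s * (1 - (norm z)\<^sup>2) = c * (1 - (norm a)\<^sup>2)"
  have harm: "\<exists>k. k holomorphic_on ball 0 1 \<and> (\<forall>\<zeta>. norm \<zeta> < 1 \<longrightarrow> Re (k \<zeta>) = f (?M \<zeta>) \<bullet> v)" for v
  proof -
    obtain k where "k holomorphic_on ball 0 1" "\<And>\<zeta>. norm \<zeta> < 1 \<Longrightarrow> Re (k \<zeta>) = f \<zeta> \<bullet> v"
      using inner_f[of v] by metis
    then show ?thesis using comp_holo M_ball by blast
  qed
  let ?N = "Moebius_function 0 z" and ?A = "Moebius_function 0 (- a)" and ?B = "Moebius_function 0 a"
  have N_ball: "norm (?N \<zeta>) < 1" if "norm \<zeta> < 1" for \<zeta> using Moebius_function_norm_lt_1 z that by blast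
  have A_ball: "norm (?A \<zeta>) < 1" if "norm \<zeta> < 1" for \<zeta>
    using Moebius_function_norm_lt_1[of "- a" \<zeta>] a that by simp
  have B_ball: "norm (?B \<zeta>) < 1" if "norm \<zeta> < 1" for \<zeta> using Moebius_function_norm_lt_1 a that by blast
  have N_holo: "?N holomorphic_on ball 0 1" and A_holo: "?A holomorphic_on ball 0 1"
    and B_holo: "?B holomorphic_on ball 0 1"
    using z a by (auto intro!: Moebius_function_holomorphic)
  have model: "f (?M \<zeta>) = C.model \<zeta>" if "norm \<zeta> < 1" for \<zeta>
    by (rule C.equality_imp_model[OF eq harm that])
  show "conformal_diffeomorphism_onto f (ball 0 1) affine_disc"
  proof (rule conformal_diffeomorphism_onto_affine_disc[OF onb p_orth,
        where \<phi> = "\<lambda>\<zeta>. of_real c * ?A (?N \<zeta>)" and \<psi> = "\<lambda>w. ?M (?B (w / of_real c))"])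
    have "(\<lambda>\<zeta>. ?A (?N \<zeta>)) holomorphic_on ball 0 1"
      using holomorphic_on_compose_gen[OF N_holo A_holo] N_ball by (simp add: o_def image_subset_iff)
    then show "(\<lambda>\<zeta>. of_real c * ?A (?N \<zeta>)) holomorphic_on ball 0 1"
      by (intro holomorphic_intros)
    have "(\<lambda>w. w / of_real c) holomorphic_on ball 0 c" using c by (intro holomorphic_intros) auto
    have c_ball: "(\<lambda>w. w / of_real c) ` ball 0 c \<subseteq> ball (0::complex) 1"
      using c by (auto simp: norm_divide)
    have "(\<lambda>\<zeta>. ?M (?B \<zeta>)) holomorphic_on ball 0 1"
      using holomorphic_on_compose_gen[OF B_holo M_holo] B_ball by (simp add: o_def image_subset_iff)
    from holomorphic_on_compose_gen[OF \<open>(\<lambda>w. w / of_real c) holomorphic_on ball 0 c\<close> this c_ball]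
    show "(\<lambda>w. ?M (?B (w / of_real c))) holomorphic_on ball 0 c" by (simp add: o_def)
  next
    fix \<zeta> :: complex assume \<zeta>: "norm \<zeta> < 1"
    show "norm (of_real c * ?A (?N \<zeta>)) < c"
      using A_ball[OF N_ball[OF \<zeta>]] c by (simp add: norm_mult)
    show "?M (?B (of_real c * ?A (?N \<zeta>) / of_real c)) = \<zeta>"
      using c \<zeta> z a by (simp add: Moebius_function_inverse N_ball)
    show "f \<zeta> = p + plane_map e1 e2 (of_real c * ?A (?N \<zeta>))"
      using model[OF N_ball[OF \<zeta>]] \<zeta> z by (simp add: Moebius_function_inverse C.model_def)
  next
    fix w :: complex assume "norm w < c"
    then have w: "norm (w / of_real c) < 1" using c by (simp add: norm_divide)
    show "norm (?M (?B (w / of_real c))) < 1" using M_ball[OF B_ball[OF w]] .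
    show "of_real c * ?A (?N (?M (?B (w / of_real c)))) = w"
      using c w z a by (simp add: Moebius_function_inverse B_ball)
  qed
qed

text \<open>In the coordinate of its affine disc, \<open>f\<close> becomes \<open>\<phi> = Re k1 + i Re k2\<close>, and conformality says
\<open>k1'\<^sup>2 + k2'\<^sup>2 = 0\<close>. The factor \<open>k1' + i k2'\<close> is \<open>2 s \<noteq> 0\<close> at \<open>z\<close>, so the other one vanishes near \<open>z\<close> and then
everywhere, which makes \<open>\<phi>\<close> holomorphic. An orientation-reversing \<open>f\<close> is covered because \<open>e1\<close>, \<open>e2\<close> are
adapted to the differential at \<open>z\<close>. The Schwarz lemma for the inverse of \<open>\<phi>\<close> bounds \<open>\<phi>'(z) = s\<close> from
below.\<close>

lemma conformal_diffeomorphism_imp_equality: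
  assumes diffeo: "conformal_diffeomorphism_onto f (ball 0 1) affine_disc"
  shows "c * (1 - (norm a)\<^sup>2) \<le> s * (1 - (norm z)\<^sup>2)"
proof -
  have bij: "bij_betw f (ball 0 1) affine_disc" and conf: "\<And>w. norm w < 1 \<Longrightarrow> conformal_at f w"
    using diffeo by (auto simp: conformal_diffeomorphism_onto_def diffeomorphism_onto_def)
  note coord = plane_coord_plane_map[OF onb p_orth]
  define \<phi> where "\<phi> = (\<lambda>\<zeta>. plane_coord e1 e2 (f \<zeta>))"
  have f_eq: "f \<zeta> = p + plane_map e1 e2 (\<phi> \<zeta>)" and \<phi>_ball: "norm (\<phi> \<zeta>) < c" if "norm \<zeta> < 1" for \<zeta>
  proof -
    have "f \<zeta> \<in> affine_disc" using bij that by (auto simp: bij_betw_def)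
    then obtain w where "norm w < c" "f \<zeta> = p + plane_map e1 e2 w" by auto
    then show "f \<zeta> = p + plane_map e1 e2 (\<phi> \<zeta>)" "norm (\<phi> \<zeta>) < c" by (simp_all add: \<phi>_def coord)
  qed
  obtain k1 where k1: "k1 holomorphic_on ball 0 1" "\<And>\<zeta>. norm \<zeta> < 1 \<Longrightarrow> Re (k1 \<zeta>) = f \<zeta> \<bullet> e1"
    "\<And>w. norm w < 1 \<Longrightarrow> deriv k1 w = Complex (partial_x f w \<bullet> e1) (- (partial_y f w \<bullet> e1))"
    using inner_f[of e1] by metis
  obtain k2 where k2: "k2 holomorphic_on ball 0 1" "\<And>\<zeta>. norm \<zeta> < 1 \<Longrightarrow> Re (k2 \<zeta>) = f \<zeta> \<bullet> e2"
    "\<And>w. norm w < 1 \<Longrightarrow> deriv k2 w = Complex (partial_x f w \<bullet> e2) (- (partial_y f w \<bullet> e2))"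
    using inner_f[of e2] by metis
  have Re_k: "\<phi> \<zeta> = Complex (Re (k1 \<zeta>)) (Re (k2 \<zeta>))" if "norm \<zeta> < 1" for \<zeta>
    using that by (simp add: \<phi>_def plane_coord_def k1 k2)
  have product: "(deriv k1 w - \<i> * deriv k2 w) * (deriv k1 w + \<i> * deriv k2 w) = 0" if w: "norm w < 1" for w
  proof -
    \<comment> \<open>The image lies in a fixed affine plane, so the differential takes its values in its direction.\<close>
    have tangent: "frechet_derivative f (at w) d
        = plane_map e1 e2 (plane_coord e1 e2 (frechet_derivative f (at w) d))" for d
    proof -
      let ?D = "frechet_derivative f (at w)"
      have D: "(f has_derivative ?D) (at w)" using f_differentiable[OF w] frechet_derivative_works by blast
      have "((\<lambda>\<zeta>. p + plane_map e1 e2 (plane_coord e1 e2 (f \<zeta>))) has_derivative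
          (\<lambda>d. 0 + plane_map e1 e2 (plane_coord e1 e2 (?D d)))) (at w)"
        by (intro has_derivative_add has_derivative_const
            bounded_linear.has_derivative[OF bounded_linear_plane_map]
            bounded_linear.has_derivative[OF bounded_linear_plane_coord] D)
      then have "(f has_derivative (\<lambda>d. 0 + plane_map e1 e2 (plane_coord e1 e2 (?D d)))) (at w)"
        by (rule has_derivative_transform_within_open[OF _ open_ball[of 0 1]])
          (use w f_eq in \<open>auto simp: \<phi>_def\<close>)
      from has_derivative_unique[OF D this] show ?thesis by (metis add_0)
    qed
    define x where "x = plane_coord e1 e2 (partial_x f w)"
    define y where "y = plane_coord e1 e2 (partial_y f w)"
    have xy: "partial_x f w = plane_map e1 e2 x" "partial_y f w = plane_map e1 e2 y"
      using tangent[of 1] tangent[of \<i>] by (simp_all add: partial_x_def partial_y_def x_def y_def)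
    have d: "deriv k1 w = Complex (Re x) (- Re y)" "deriv k2 w = Complex (Im x) (- Im y)"
      using w by (simp_all add: k1(3) k2(3) x_def y_def plane_coord_def)
    have "norm x = norm y" "Re (cnj x * y) = 0"
      using conf[OF w] unfolding conformal_at_def xy
      by (simp_all only: norm_plane_map[OF onb] plane_map_inner_plane_map[OF onb])
    then have "(Re x)\<^sup>2 + (Im x)\<^sup>2 = (Re y)\<^sup>2 + (Im y)\<^sup>2" "Re x * Re y + Im x * Im y = 0"
      by (simp_all add: cmod_def)
    then show ?thesis
      unfolding d by (simp add: complex_eq_iff algebra_simps power2_eq_square)
  qed
  have dk: "deriv k1 z = of_real s" "deriv k2 z = - \<i> * of_real s"
    using onb z by (simp_all add: k1(3) k2(3) partials complex_eq_iff inner_commute dot_square_norm)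
  define U where "U = ball 0 1 \<inter> (\<lambda>w. deriv k1 w + \<i> * deriv k2 w) -` (- {0})"
  have dh: "deriv k1 holomorphic_on ball 0 1" "deriv k2 holomorphic_on ball 0 1"
    using k1 k2 by (auto intro!: holomorphic_deriv)
  have "open U"
    unfolding U_def
    by (intro continuous_open_preimage holomorphic_on_imp_continuous_on holomorphic_intros dh) auto
  have "z \<in> U" using s z by (simp add: U_def dk)
  have anti: "deriv k1 w - \<i> * deriv k2 w = 0" if "norm w < 1" for w
  proof (rule analytic_continuation_open[where s = U and s' = "ball 0 1" and g = "\<lambda>_. 0"
        and f = "\<lambda>w. deriv k1 w - \<i> * deriv k2 w"])
    show "deriv k1 w - \<i> * deriv k2 w = 0" if "w \<in> U" for w
      using that product[of w] by (auto simp: U_def)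
  qed (use \<open>open U\<close> \<open>z \<in> U\<close> that dh in \<open>auto simp: U_def intro!: holomorphic_intros\<close>)
  have "\<exists>C. \<forall>w\<in>ball 0 1. k1 w - \<i> * k2 w = C"
  proof (rule has_derivative_zero_constant[OF convex_ball])
    fix w :: complex assume w: "w \<in> ball 0 1"
    have "((\<lambda>w. k1 w - \<i> * k2 w) has_field_derivative deriv k1 w - \<i> * deriv k2 w) (at w)"
      using holomorphic_derivI[OF k1(1) open_ball w] holomorphic_derivI[OF k2(1) open_ball w]
      by (intro DERIV_diff DERIV_cmult)
    then have "((\<lambda>w. k1 w - \<i> * k2 w) has_derivative (*) 0) (at w)"
      using anti[of w] w by (simp add: has_field_derivative_def)
    moreover have "(*) 0 = (\<lambda>h::complex. 0)" by auto
    ultimately show "((\<lambda>w. k1 w - \<i> * k2 w) has_derivative (\<lambda>h. 0)) (at w within ball 0 1)"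
      using has_derivative_at_withinI by metis
  qed
  then obtain C where C: "\<And>w. norm w < 1 \<Longrightarrow> k1 w = C + \<i> * k2 w"
    by (auto simp: algebra_simps)
  have \<phi>_eq: "\<phi> w = of_real (Re C) + \<i> * k2 w" if "norm w < 1" for w
    using C[OF that] by (simp add: Re_k[OF that] complex_eq_iff)
  have \<phi>_holo: "\<phi> holomorphic_on ball 0 1"
    by (rule holomorphic_transform[of "\<lambda>w. of_real (Re C) + \<i> * k2 w"])
      (auto intro!: holomorphic_intros k2(1) simp: \<phi>_eq)
  have "(\<phi> has_field_derivative of_real s) (at z)"
  proof (rule has_field_derivative_transform_within_open[OF _ open_ball])
    have "(k2 has_field_derivative - \<i> * of_real s) (at z)"
      using holomorphic_derivI[OF k2(1) open_ball] z unfolding dk(2)[symmetric] by simp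
    from DERIV_add[OF DERIV_const DERIV_cmult[OF this, of \<i>]]
    show "((\<lambda>w. of_real (Re C) + \<i> * k2 w) has_field_derivative of_real s) (at z)"
      by simp
    show "z \<in> ball 0 1" using z by simp
  qed (simp add: \<phi>_eq)
  then have \<phi>'z: "deriv \<phi> z = of_real s" by (rule DERIV_imp_deriv)
  have \<phi>_inj: "inj_on \<phi> (ball 0 1)"
  proof (rule inj_onI)
    fix x y assume xy: "x \<in> ball 0 1" "y \<in> ball 0 1" "\<phi> x = \<phi> y"
    then have "f x = f y" using f_eq by (metis mem_ball_0)
    then show "x = y" using bij xy by (auto simp: bij_betw_def inj_on_def)
  qed
  have \<phi>_img: "\<phi> ` ball 0 1 = ball 0 c"
  proof (intro equalityI subsetI)
    fix w :: complex assume "w \<in> ball 0 c"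
    then have "p + plane_map e1 e2 w \<in> f ` ball 0 1" using bij by (auto simp: bij_betw_def)
    then obtain \<zeta> where "norm \<zeta> < 1" "p + plane_map e1 e2 w = f \<zeta>" by auto
    then have "\<phi> \<zeta> = w" by (metis \<phi>_def coord)
    then show "w \<in> \<phi> ` ball 0 1" using \<open>norm \<zeta> < 1\<close> by auto
  qed (use \<phi>_ball in auto)
  obtain K where K: "K holomorphic_on ball 0 c" "\<And>\<zeta>. \<zeta> \<in> ball 0 1 \<Longrightarrow> deriv \<phi> \<zeta> * deriv K (\<phi> \<zeta>) = 1"
    "\<And>\<zeta>. \<zeta> \<in> ball 0 1 \<Longrightarrow> K (\<phi> \<zeta>) = \<zeta>"
    using holomorphic_has_inverse[OF \<phi>_holo open_ball \<phi>_inj] unfolding \<phi>_img by metis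
  have \<phi>z: "\<phi> z = of_real c * a" by (simp add: \<phi>_def fz coord)
  have K_ball: "norm (K w) < 1" if "norm w < c" for w
  proof -
    have "w \<in> \<phi> ` ball 0 1" using that \<phi>_img by simp
    then show ?thesis using K(3) by auto
  qed
  let ?A = "Moebius_function 0 (- a)" and ?N = "Moebius_function 0 z"
  have A_ball: "norm (of_real c * ?A \<zeta>) < c" if "norm \<zeta> < 1" for \<zeta>
    using Moebius_function_norm_lt_1[of "- a" \<zeta>] a that c by (simp add: norm_mult)
  \<comment> \<open>A self-map of the unit disc that fixes the origin, built from the inverse of \<open>\<phi>\<close>.\<close>
  define Q where "Q = (\<lambda>\<zeta>. ?N (K (of_real c * ?A \<zeta>)))"
  have "(\<lambda>\<zeta>. of_real c * ?A \<zeta>) holomorphic_on ball 0 1"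
    using a by (intro holomorphic_intros Moebius_function_holomorphic) simp
  from holomorphic_on_compose_gen[OF this K(1)]
  have "(\<lambda>\<zeta>. K (of_real c * ?A \<zeta>)) holomorphic_on ball 0 1"
    using A_ball by (simp add: o_def image_subset_iff)
  from holomorphic_on_compose_gen[OF this Moebius_function_holomorphic[OF z]]
  have Q_holo: "Q holomorphic_on ball 0 1"
    using A_ball K_ball by (simp add: o_def Q_def image_subset_iff)
  have A0: "of_real c * ?A 0 = \<phi> z" by (simp add: Moebius_function_0_eq \<phi>z)
  have Kz: "K (\<phi> z) = z" using K(3) z by simp
  have Q0: "Q 0 = 0" by (simp only: Q_def A0 Kz Moebius_function_eq_zero)
  have Q_ball: "norm (Q \<zeta>) < 1" if "norm \<zeta> < 1" for \<zeta>
    unfolding Q_def by (intro Moebius_function_norm_lt_1 z K_ball A_ball that)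
  have Schwarz: "norm (deriv Q 0) \<le> 1"
    by (rule Schwarz_Lemma(2)[OF Q_holo Q0 Q_ball, of 0]) auto
  have z2: "(norm z)\<^sup>2 < 1" using z by (simp add: power_less_one_iff)
  have a2: "(norm a)\<^sup>2 < 1" using a by (simp add: power_less_one_iff)
  have cz: "1 - cnj z * z = of_real (1 - (norm z)\<^sup>2)"
    unfolding of_real_diff complex_norm_square by (simp add: mult.commute)
  have nz: "1 - cnj z * z \<noteq> 0" unfolding cz of_real_eq_0_iff using z2 by simp
  have A': "((\<lambda>\<zeta>. of_real c * ?A \<zeta>) has_field_derivative of_real c * of_real (1 - (norm a)\<^sup>2)) (at 0)"
    using DERIV_cmult[OF DERIV_Moebius_function[of "- a" 0], of "of_real c"] by simp
  have K': "(K has_field_derivative deriv K (\<phi> z)) (at (of_real c * ?A 0))"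
    unfolding A0 using holomorphic_derivI[OF K(1) open_ball] \<phi>_ball z by simp
  have N': "(?N has_field_derivative of_real (1 - (norm z)\<^sup>2) / (1 - cnj z * z)\<^sup>2) (at (K (of_real c * ?A 0)))"
    unfolding A0 Kz by (rule DERIV_Moebius_function[OF nz])
  have "deriv Q 0 = of_real (1 - (norm z)\<^sup>2) / (1 - cnj z * z)\<^sup>2 * (deriv K (\<phi> z) * (of_real c * of_real (1 - (norm a)\<^sup>2)))"
    unfolding Q_def by (rule DERIV_imp_deriv[OF DERIV_chain2[OF N' DERIV_chain2[OF K' A']]])
  also have "deriv K (\<phi> z) = of_real (1 / s)"
    using K(2)[of z] z s unfolding \<phi>'z by (simp add: field_simps)
  finally have "deriv Q 0 = of_real (c * (1 - (norm a)\<^sup>2) / (s * (1 - (norm z)\<^sup>2)))"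
    unfolding cz using z2 s by (simp add: power2_eq_square)
  then have "norm (deriv Q 0) = c * (1 - (norm a)\<^sup>2) / (s * (1 - (norm z)\<^sup>2))"
    using z2 a2 s c by (simp only: norm_of_real) (auto intro!: divide_nonneg_pos)
  with Schwarz show ?thesis using z2 s by (simp add: pos_divide_le_eq)
qed

end

section \<open>Schwarz-Pick inequality at a conformal point\<close>

theorem theorem2p1:
  fixes f :: "complex \<Rightarrow> real ^ 'n"
    and z :: complex
    and \<theta> :: real
    and \<Lambda> :: "(real ^ 'n) set"
  assumes "CARD('n) \<ge> 2"
    and "harmonic_map_on (ball 0 1) f"
    and "f ` ball 0 1 \<subseteq> ball 0 1"
    and "z \<in> ball 0 1"
    and "conformal_at f z"
    and "\<Lambda> = range (frechet_derivative f (at z))"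
    and "\<theta> \<in> {0..pi / 2}"
    and "f z \<noteq> 0 \<Longrightarrow> \<Lambda> \<noteq> {0} \<Longrightarrow> \<theta> = angle_to_subspace (f z) \<Lambda>"
  shows "onorm (frechet_derivative f (at z)) = 1 / sqrt 2 * grad_norm f z
    \<and> 1 / sqrt 2 * grad_norm f z
        \<le> (1 - (norm (f z))\<^sup>2) / (1 - (norm z)\<^sup>2) * (1 / sqrt (1 - (norm (f z))\<^sup>2 * (sin \<theta>)\<^sup>2))
    \<and> (1 / sqrt 2 * grad_norm f z
          = (1 - (norm (f z))\<^sup>2) / (1 - (norm z)\<^sup>2) * (1 / sqrt (1 - (norm (f z))\<^sup>2 * (sin \<theta>)\<^sup>2))
        \<longleftrightarrow> conformal_diffeomorphism_onto f (ball 0 1) ((\<lambda>v. f z + v) ` \<Lambda> \<inter> ball 0 1))"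
proof -
  define q where "q = f z"
  define s where "s = norm (partial_x f z)"
  define R where "R = (1 - (norm q)\<^sup>2) / (1 - (norm z)\<^sup>2) * (1 / sqrt (1 - (norm q)\<^sup>2 * (sin \<theta>)\<^sup>2))"
  have f_ball: "norm (f \<zeta>) < 1" if "norm \<zeta> < 1" for \<zeta>
    using assms(3) that by (simp add: image_subset_iff)
  have z: "norm z < 1" using assms(4) by simp
  have q: "norm q < 1" using f_ball[OF z] by (simp add: q_def)
  have q2: "(norm q)\<^sup>2 < 1" and z2: "(norm z)\<^sup>2 < 1" using q z by (simp_all add: power_less_one_iff)
  have df: "frechet_derivative f (at z) d = Re d *\<^sub>R partial_x f z + Im d *\<^sub>R partial_y f z" for d
    by (rule frechet_derivative_complex_direction[OF harmonic_map_differentiable[OF assms(2,4)]])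
  have sy: "norm (partial_y f z) = s" and orth: "partial_x f z \<bullet> partial_y f z = 0"
    using assms(5) by (simp_all add: conformal_at_def s_def)
  have "grad_norm f z = sqrt (2 * s\<^sup>2)" by (simp add: grad_norm_def sy flip: s_def)
  then have grad: "1 / sqrt 2 * grad_norm f z = s" by (simp add: real_sqrt_mult s_def)
  have "(norm q)\<^sup>2 * (sin \<theta>)\<^sup>2 \<le> (norm q)\<^sup>2 * 1"
    by (intro mult_left_mono) (simp_all add: abs_square_le_1)
  then have R_pos: "0 < R" using q2 z2 by (simp add: R_def)
  have "onorm (frechet_derivative f (at z)) = s \<and> s \<le> R \<and>
    (s = R \<longleftrightarrow> conformal_diffeomorphism_onto f (ball 0 1) ((\<lambda>v. q + v) ` \<Lambda> \<inter> ball 0 1))"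
  proof (cases "s = 0")
    case True
    then have "partial_x f z = 0" "partial_y f z = 0" using sy by (simp_all add: s_def)
    then have D0: "frechet_derivative f (at z) = (\<lambda>d. 0)" by (simp add: df fun_eq_iff)
    then have L: "\<Lambda> = {0}" using assms(6) by auto
    have "\<not> conformal_diffeomorphism_onto f (ball 0 1) ((\<lambda>v. q + v) ` \<Lambda> \<inter> ball 0 1)"
    proof
      assume "conformal_diffeomorphism_onto f (ball 0 1) ((\<lambda>v. q + v) ` \<Lambda> \<inter> ball 0 1)"
      then have "bij_betw f (ball 0 1) ((\<lambda>v. q + v) ` \<Lambda> \<inter> ball 0 1)"
        by (simp add: conformal_diffeomorphism_onto_def diffeomorphism_onto_def)
      then have inj: "inj_on f (ball 0 1)" and "f ` ball 0 1 \<subseteq> {q}" by (auto simp: L bij_betw_def)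
      then have "f 0 = q" "f (1 / 2) = q" by (auto simp: image_subset_iff)
      with inj_onD[OF inj, of 0 "1 / 2"] show False by simp
    qed
    then show ?thesis using True R_pos by (simp add: D0 onorm_zero)
  next
    case False
    then have s: "0 < s" by (simp add: s_def)
    define e1 where "e1 = (1 / s) *\<^sub>R partial_x f z"
    define e2 where "e2 = (1 / s) *\<^sub>R partial_y f z"
    have partials: "partial_x f z = s *\<^sub>R e1" "partial_y f z = s *\<^sub>R e2"
      using s by (simp_all add: e1_def e2_def)
    have on: "norm e1 = 1" "norm e2 = 1" "e1 \<bullet> e2 = 0"
      using s sy orth by (simp_all add: e1_def e2_def s_def[symmetric])
    have D: "frechet_derivative f (at z) = (\<lambda>d. s *\<^sub>R plane_map e1 e2 d)"
      by (simp add: fun_eq_iff df partials plane_map_def algebra_simps)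
    have L: "\<Lambda> = range (plane_map e1 e2)"
    proof -
      have "s *\<^sub>R plane_map e1 e2 d = plane_map e1 e2 (of_real s * d)" for d
        by (simp add: plane_map_def algebra_simps)
      moreover have "plane_map e1 e2 d = s *\<^sub>R plane_map e1 e2 (d / of_real s)" for d
        using s by (simp add: plane_map_def algebra_simps)
      ultimately show ?thesis unfolding assms(6) D
        by (metis (no_types, lifting) image_eqI rangeE subsetI subset_antisym UNIV_I)
    qed
    define b where "b = Complex (q \<bullet> e1) (q \<bullet> e2)"
    define p where "p = q - plane_map e1 e2 b"
    have p: "p \<bullet> e1 = 0" "p \<bullet> e2 = 0"
      using on by (simp_all add: p_def b_def plane_map_def inner_diff_left inner_diff_right
          inner_add_left inner_add_right dot_square_norm inner_commute)
    have pyth: "(norm q)\<^sup>2 = (norm p)\<^sup>2 + (norm b)\<^sup>2"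
    proof -
      have "q = p + plane_map e1 e2 b" by (simp add: p_def)
      then have "(norm q)\<^sup>2 = (norm p)\<^sup>2 + (norm (plane_map e1 e2 b))\<^sup>2"
        using p by (simp add: power2_norm_eq_inner inner_add_left inner_add_right inner_commute plane_map_def)
      then show ?thesis by (simp add: norm_plane_map[OF on])
    qed
    define c where "c = sqrt (1 - (norm p)\<^sup>2)"
    have p2: "(norm p)\<^sup>2 < 1" using pyth q2 zero_le_power2[of "norm b"] by linarith
    have c: "0 < c" "c\<^sup>2 + (norm p)\<^sup>2 = 1" using p2 by (simp_all add: c_def)
    define a where "a = b / of_real c"
    have b: "b = of_real c * a" using c by (simp add: a_def)
    have na: "(norm a)\<^sup>2 = (norm b)\<^sup>2 / c\<^sup>2" by (simp add: a_def norm_divide power_divide)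
    have "(norm b)\<^sup>2 < c\<^sup>2" using pyth c q2 by linarith
    then have "(norm a)\<^sup>2 < 1" using c by (simp add: na)
    then have a: "norm a < 1" by (simp add: power_less_one_iff)
    \<comment> \<open>For \<open>q = 0\<close> both sides vanish, whatever \<open>\<theta>\<close> is.\<close>
    have "(norm q)\<^sup>2 * (sin \<theta>)\<^sup>2 = (norm p)\<^sup>2"
    proof (cases "q = 0")
      case True
      then show ?thesis using pyth by (simp add: sum_power2_eq_zero_iff)
    next
      case False
      have "plane_map e1 e2 1 \<noteq> 0" using norm_plane_map[OF on, of 1] by (metis norm_zero norm_one zero_neq_one)
      then have "\<Lambda> \<noteq> {0}" unfolding L by (metis rangeI singletonD)
      then have "\<theta> = angle_to_subspace q (range (plane_map e1 e2))"
        using assms(8) False by (simp add: q_def L)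
      then show ?thesis using norm_sin_angle_to_plane[OF on False] pyth by (simp add: b_def)
    qed
    then have R: "R = c * (1 - (norm a)\<^sup>2) / (1 - (norm z)\<^sup>2)"
    proof -
      have "1 - (norm q)\<^sup>2 = c\<^sup>2 - (norm b)\<^sup>2" using pyth c by linarith
      also have "\<dots> = c * (c * (1 - (norm a)\<^sup>2))"
        by (simp add: b norm_mult power2_eq_square algebra_simps)
      finally have "1 - (norm q)\<^sup>2 = c * (c * (1 - (norm a)\<^sup>2))" .
      then show ?thesis
        using c \<open>(norm q)\<^sup>2 * (sin \<theta>)\<^sup>2 = (norm p)\<^sup>2\<close> by (simp add: R_def c_def[symmetric])
    qed
    have fz: "f z = p + plane_map e1 e2 (of_real c * a)" by (simp add: p_def q_def flip: b)
    interpret conformal_harmonic_disc f z p e1 e2 a c s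
      by unfold_locales (fact assms(2) f_ball z on p c a fz s partials)+
    have \<Sigma>: "(\<lambda>v. q + v) ` \<Lambda> \<inter> ball 0 1 = affine_disc"
      using affine_plane_Int_ball[OF on p c, of "of_real c * a"] by (simp add: q_def fz L)
    have z3: "0 < 1 - (norm z)\<^sup>2" using z2 by simp
    have "s \<le> R" using bound_and_equality_case(1) z3 by (simp add: R pos_le_divide_eq)
    moreover have "s = R \<longleftrightarrow> conformal_diffeomorphism_onto f (ball 0 1) affine_disc"
    proof
      assume "s = R"
      then show "conformal_diffeomorphism_onto f (ball 0 1) affine_disc"
        using bound_and_equality_case(2) z3 by (simp add: R)
    next
      assume "conformal_diffeomorphism_onto f (ball 0 1) affine_disc"
      from conformal_diffeomorphism_imp_equality[OF this]
      have "R \<le> s" using z3 by (simp add: R pos_divide_le_eq)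
      with \<open>s \<le> R\<close> show "s = R" by simp
    qed
    moreover have "onorm (frechet_derivative f (at z)) = s"
      unfolding D using s by (intro onorm_scaled_plane_map on) simp
    ultimately show ?thesis unfolding \<Sigma> by simp
  qed
  then show ?thesis unfolding grad R_def q_def .
qed

end
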